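(* Let $a_1,\dots,a_n,\delta$ be positive integers with $\beta:=\max\{a_i : i\in\{1,\dots,n\}\}\geq2$, and let $I=(a_1,\dots,a_n,\delta)$ be the corresponding instance of KNAPSACK: $$(KP)\qquad\max_x\ \sum_{i=1}^na_ix_i\quad\text{s.t.}\quad\sum_{i=1}^na_ix_i\leq\delta,\ x\in\{0,1\}^n.$$ Choose $M>\beta^2$ and consider the optimistic linear bilevel problem $$(BL_M)\qquad\max_{x,y}\ \sum_{i=1}^na_ix_i-M\sum_{i=1}^ny_i\quad\text{s.t.}\quad\begin{cases}\sum_{i=1}^na_ix_i\leq\delta,\\ x\in[0,1]^n,\\ y\in\operatorname{argmax}_{y'}\left\{\sum_{i=1}^ny'_i : y'\leq x,\ y'\leq\mathbf{1}-x,\ y'\geq0\right\}.\end{cases}$$ If $(x,y)$ is a feasible point of $(BL_M)$ with $x$ not integer, then there exists $z\in\{0,1\}^n$ such that $(z,0)$ is also feasible for $(BL_M)$ and $$\sum_{i=1}^na_ix_i-M\sum_{i=1}^ny_i<\sum_{i=1}^na_iz_i.$$ In particular, every optimal solution $(x,y)$ of $(BL_M)$ is integer, and therefore its first coordinate $x$ is also a solution of $(KP)$. Therefore, choosing $M=\beta^2+1$ induces a polynomial-time reduction of $I$ to $(BL_M)$.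
   Context: Vector inequalities are componentwise, and $\mathbf{1}$ is the all-ones vector of $\mathbb{R}^n$. Encodings of instances are binary; $|J|$ denotes the encoding length of an instance $J$. A polynomial-time reduction from a class of problems $\mathcal{J}$ to a class $\mathcal{I}$ is an algorithm that, given $J\in\mathcal{J}$, computes an associated instance of $\mathcal{I}$ in time polynomial in $|J|$, and which, from any solution of that instance (of size polynomial in $|J|$), solves $J$ in time polynomial in $|J|$. *)

theory Defs
  imports
    "Jordan_Normal_Form.Matrix"
    "HOL-Computational_Algebra.Polynomial"
    "HOL-Library.Log_Nat"
begin

definition max_entry :: "int vec \<Rightarrow> int" where
  "max_entry a = Max ((\<lambda>i. a $ i) ` {..<dim_vec a})"

definition kp_instances :: "(int vec \<times> int) set" where
  "kp_instances = {(a, \<delta>). 0 < dim_vec a \<and> (\<forall>i<dim_vec a. 0 < a $ i) \<and> 0 < \<delta> \<and> 2 \<le> max_entry a}"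

definition binary_vec :: "nat \<Rightarrow> real vec \<Rightarrow> bool" where
  "binary_vec n z \<longleftrightarrow> z \<in> carrier_vec n \<and> (\<forall>i<n. z $ i \<in> {0, 1})"

definition integer_vec :: "real vec \<Rightarrow> bool" where
  "integer_vec x \<longleftrightarrow> (\<forall>i<dim_vec x. x $ i \<in> \<int>)"

definition weight :: "int vec \<Rightarrow> real vec \<Rightarrow> real" where
  "weight a x = (\<Sum>i<dim_vec a. real_of_int (a $ i) * x $ i)"

definition kp_feasible :: "int vec \<Rightarrow> int \<Rightarrow> real vec \<Rightarrow> bool" where
  "kp_feasible a \<delta> x \<longleftrightarrow> binary_vec (dim_vec a) x \<and> weight a x \<le> real_of_int \<delta>"

definition kp_optimal :: "int vec \<Rightarrow> int \<Rightarrow> real vec \<Rightarrow> bool" where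
  "kp_optimal a \<delta> x \<longleftrightarrow> is_arg_max (weight a) (kp_feasible a \<delta>) x"

definition ones_vec :: "nat \<Rightarrow> 'a::one vec" where
  "ones_vec n = vec n (\<lambda>_. 1)"

text \<open>The order on vectors is the componentwise one of the library; it forces equal dimensions.\<close>

definition follower_feasible :: "nat \<Rightarrow> real vec \<Rightarrow> real vec \<Rightarrow> bool" where
  "follower_feasible n x y \<longleftrightarrow> y \<le> x \<and> y \<le> ones_vec n - x \<and> 0\<^sub>v n \<le> y"

definition bl_feasible :: "int vec \<Rightarrow> int \<Rightarrow> real vec \<times> real vec \<Rightarrow> bool" where
  "bl_feasible a \<delta> = (\<lambda>(x, y).
     weight a x \<le> real_of_int \<delta> \<and>
     0\<^sub>v (dim_vec a) \<le> x \<and> x \<le> ones_vec (dim_vec a) \<and>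
     is_arg_max (\<lambda>y'. \<Sum>i<dim_vec a. y' $ i) (follower_feasible (dim_vec a) x) y)"

definition bl_objective :: "int vec \<Rightarrow> real \<Rightarrow> real vec \<times> real vec \<Rightarrow> real" where
  "bl_objective a M = (\<lambda>(x, y). weight a x - M * (\<Sum>i<dim_vec a. y $ i))"

definition bl_optimal :: "int vec \<Rightarrow> int \<Rightarrow> real \<Rightarrow> real vec \<times> real vec \<Rightarrow> bool" where
  "bl_optimal a \<delta> M p \<longleftrightarrow> is_arg_max (bl_objective a M) (bl_feasible a \<delta>) p"

text \<open>
  A record \<open>L\<close> stands for the problem
    max \<open>c x + d y\<close> over \<open>(x, y)\<close> subject to \<open>A x + B y \<le> b\<close> and
    \<open>y\<close> in argmax \<open>{e y' : C x + D y' \<le> f}\<close>.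
\<close>

record lbp =
  lbp_c :: "rat vec"
  lbp_d :: "rat vec"
  lbp_A :: "rat mat"
  lbp_B :: "rat mat"
  lbp_b :: "rat vec"
  lbp_e :: "rat vec"
  lbp_C :: "rat mat"
  lbp_D :: "rat mat"
  lbp_f :: "rat vec"

definition lbp_instances :: "lbp set" where
  "lbp_instances = {L. \<exists>nx ny k l.
     lbp_c L \<in> carrier_vec nx \<and> lbp_d L \<in> carrier_vec ny \<and>
     lbp_A L \<in> carrier_mat k nx \<and> lbp_B L \<in> carrier_mat k ny \<and> lbp_b L \<in> carrier_vec k \<and>
     lbp_e L \<in> carrier_vec ny \<and>
     lbp_C L \<in> carrier_mat l nx \<and> lbp_D L \<in> carrier_mat l ny \<and> lbp_f L \<in> carrier_vec l}"

abbreviation rvec :: "rat vec \<Rightarrow> real vec" where "rvec \<equiv> map_vec of_rat"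
abbreviation rmat :: "rat mat \<Rightarrow> real mat" where "rmat \<equiv> map_mat of_rat"

definition lbp_follower_feasible :: "lbp \<Rightarrow> real vec \<Rightarrow> real vec \<Rightarrow> bool" where
  "lbp_follower_feasible L x y \<longleftrightarrow> y \<in> carrier_vec (dim_vec (lbp_d L)) \<and>
     rmat (lbp_C L) *\<^sub>v x + rmat (lbp_D L) *\<^sub>v y \<le> rvec (lbp_f L)"

definition lbp_feasible :: "lbp \<Rightarrow> real vec \<times> real vec \<Rightarrow> bool" where
  "lbp_feasible L = (\<lambda>(x, y).
     x \<in> carrier_vec (dim_vec (lbp_c L)) \<and> y \<in> carrier_vec (dim_vec (lbp_d L)) \<and>
     rmat (lbp_A L) *\<^sub>v x + rmat (lbp_B L) *\<^sub>v y \<le> rvec (lbp_b L) \<and>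
     is_arg_max (\<lambda>y'. rvec (lbp_e L) \<bullet> y') (lbp_follower_feasible L x) y)"

definition lbp_objective :: "lbp \<Rightarrow> real vec \<times> real vec \<Rightarrow> real" where
  "lbp_objective L = (\<lambda>(x, y). rvec (lbp_c L) \<bullet> x + rvec (lbp_d L) \<bullet> y)"

definition lbp_optimal :: "lbp \<Rightarrow> real vec \<times> real vec \<Rightarrow> bool" where
  "lbp_optimal L p \<longleftrightarrow> is_arg_max (lbp_objective L) (lbp_feasible L) p"

text \<open>
  The problem given by \<open>bl_feasible\<close> and \<open>bl_objective\<close> as explicit data. Leader rows: \<open>a x \<le> \<delta>\<close>, \<open>x \<le> 1\<close>,
  \<open>-x \<le> 0\<close>; follower rows: \<open>-x + y \<le> 0\<close>, \<open>x + y \<le> 1\<close>, \<open>-y \<le> 0\<close>.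
  That it is the same problem is proved in \<open>lbp_feasible_bl_lbp\<close>, \<open>lbp_objective_bl_lbp\<close>
  and \<open>lbp_optimal_bl_lbp\<close>.
\<close>

definition bl_lbp :: "int vec \<Rightarrow> int \<Rightarrow> int \<Rightarrow> lbp" where
  "bl_lbp a \<delta> M = (let n = dim_vec a; w = map_vec rat_of_int a in
     \<lparr> lbp_c = w,
       lbp_d = vec n (\<lambda>_. - rat_of_int M),
       lbp_A = mat_of_rows n [w] @\<^sub>r 1\<^sub>m n @\<^sub>r - 1\<^sub>m n,
       lbp_B = 0\<^sub>m (1 + (n + n)) n,
       lbp_b = vec 1 (\<lambda>_. rat_of_int \<delta>) @\<^sub>v ones_vec n @\<^sub>v 0\<^sub>v n,
       lbp_e = ones_vec n,
       lbp_C = - 1\<^sub>m n @\<^sub>r 1\<^sub>m n @\<^sub>r 0\<^sub>m n n,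
       lbp_D = 1\<^sub>m n @\<^sub>r 1\<^sub>m n @\<^sub>r - 1\<^sub>m n,
       lbp_f = 0\<^sub>v n @\<^sub>v ones_vec n @\<^sub>v 0\<^sub>v n \<rparr>)"

text \<open>
  The model of computation is the random access machine of Cook--Reckhow and
  Aho--Hopcroft--Ullman: an integer memory with direct and indirect addressing, a read-only input
  tape and a write-only output tape of integers. Every step is charged the binary lengths of all
  integers and addresses it touches, so polynomial time here is polynomial time on Turing machines.
  The control flow is structured (while programs) instead of jumps.
\<close>

definition int_size :: "int \<Rightarrow> nat" where
  "int_size k = 1 + nat (bitlen \<bar>k\<bar>)"

definition tape_size :: "int list \<Rightarrow> nat" where
  "tape_size us = (\<Sum>k\<leftarrow>us. int_size k)"

datatype loc = Dir int | Ind int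

datatype operand = Const int | Loc loc

datatype binop = Add | Sub | Mul | Div

datatype test = Less operand operand | Equal operand operand

datatype com =
    Skip
  | Arith loc binop operand operand
  | Read loc
  | Write operand
  | Seq com com
  | If test com com
  | While test com

record state =
  mem :: "int \<Rightarrow> int"
  inp :: "int list"
  out :: "int list"

fun address :: "state \<Rightarrow> loc \<Rightarrow> int" where
  "address s (Dir i) = i"
| "address s (Ind i) = mem s i"

fun loc_cost :: "state \<Rightarrow> loc \<Rightarrow> nat" where
  "loc_cost s (Dir i) = int_size i"
| "loc_cost s (Ind i) = int_size i + int_size (mem s i)"

fun operand_val :: "state \<Rightarrow> operand \<Rightarrow> int" where
  "operand_val s (Const k) = k"
| "operand_val s (Loc l) = mem s (address s l)"

fun operand_cost :: "state \<Rightarrow> operand \<Rightarrow> nat" where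
  "operand_cost s (Const k) = int_size k"
| "operand_cost s (Loc l) = loc_cost s l + int_size (mem s (address s l))"

fun binop_val :: "binop \<Rightarrow> int \<Rightarrow> int \<Rightarrow> int" where
  "binop_val Add u v = u + v"
| "binop_val Sub u v = u - v"
| "binop_val Mul u v = u * v"
| "binop_val Div u v = u div v"

fun test_val :: "state \<Rightarrow> test \<Rightarrow> bool" where
  "test_val s (Less u v) \<longleftrightarrow> operand_val s u < operand_val s v"
| "test_val s (Equal u v) \<longleftrightarrow> operand_val s u = operand_val s v"

fun test_cost :: "state \<Rightarrow> test \<Rightarrow> nat" where
  "test_cost s (Less u v) = operand_cost s u + operand_cost s v"
| "test_cost s (Equal u v) = operand_cost s u + operand_cost s v"

definition store :: "loc \<Rightarrow> int \<Rightarrow> state \<Rightarrow> state" where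
  "store l k s = s\<lparr>mem := (mem s)(address s l := k)\<rparr>"

text \<open>Reading beyond the end of the input yields \<open>0\<close>.\<close>

definition next_input :: "state \<Rightarrow> int" where
  "next_input s = (case inp s of [] \<Rightarrow> 0 | k # _ \<Rightarrow> k)"

text \<open>\<open>exec c s t s'\<close>: started in \<open>s\<close>, the program \<open>c\<close> halts in \<open>s'\<close> at total cost \<open>t\<close>.\<close>

inductive exec :: "com \<Rightarrow> state \<Rightarrow> nat \<Rightarrow> state \<Rightarrow> bool" where
  Skip: "exec Skip s 1 s"
| Arith: "exec (Arith l f u v) s (loc_cost s l + operand_cost s u + operand_cost s v)
            (store l (binop_val f (operand_val s u) (operand_val s v)) s)"
| Read: "exec (Read l) s (loc_cost s l + int_size (next_input s))
           ((store l (next_input s) s)\<lparr>inp := tl (inp s)\<rparr>)"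
| Write: "exec (Write u) s (operand_cost s u) (s\<lparr>out := out s @ [operand_val s u]\<rparr>)"
| Seq: "exec c1 s t1 s' \<Longrightarrow> exec c2 s' t2 s'' \<Longrightarrow> exec (Seq c1 c2) s (t1 + t2) s''"
| IfTrue: "test_val s b \<Longrightarrow> exec c1 s t s' \<Longrightarrow> exec (If b c1 c2) s (test_cost s b + t) s'"
| IfFalse: "\<not> test_val s b \<Longrightarrow> exec c2 s t s' \<Longrightarrow> exec (If b c1 c2) s (test_cost s b + t) s'"
| WhileFalse: "\<not> test_val s b \<Longrightarrow> exec (While b c) s (test_cost s b) s"
| WhileTrue: "test_val s b \<Longrightarrow> exec c s t1 s' \<Longrightarrow> exec (While b c) s' t2 s'' \<Longrightarrow>
    exec (While b c) s (test_cost s b + t1 + t2) s''"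

definition computes_within :: "com \<Rightarrow> int list \<Rightarrow> int list \<Rightarrow> nat \<Rightarrow> bool" where
  "computes_within c us vs T \<longleftrightarrow>
     (\<exists>t s. exec c \<lparr>mem = (\<lambda>_. 0), inp = us, out = []\<rparr> t s \<and> out s = vs \<and> t \<le> T)"

record ('i, 's) problem =
  instances :: "'i set"
  solution :: "'i \<Rightarrow> 's \<Rightarrow> bool"
  enc_inst :: "'i \<Rightarrow> int list"
  enc_sol :: "'s \<Rightarrow> int list"

definition enc_rat :: "rat \<Rightarrow> int list" where
  "enc_rat q = (case quotient_of q of (k, m) \<Rightarrow> [k, m])"

definition enc_vec :: "('a \<Rightarrow> int list) \<Rightarrow> 'a vec \<Rightarrow> int list" where
  "enc_vec e v = int (dim_vec v) # concat (map e (list_of_vec v))"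

definition enc_mat :: "('a \<Rightarrow> int list) \<Rightarrow> 'a mat \<Rightarrow> int list" where
  "enc_mat e A = int (dim_row A) # int (dim_col A) #
     concat (map (\<lambda>r. concat (map e (list_of_vec r))) (rows A))"

definition enc_kp :: "int vec \<times> int \<Rightarrow> int list" where
  "enc_kp = (\<lambda>(a, \<delta>). enc_vec (\<lambda>k. [k]) a @ [\<delta>])"

definition enc_lbp :: "lbp \<Rightarrow> int list" where
  "enc_lbp L =
     enc_vec enc_rat (lbp_c L) @ enc_vec enc_rat (lbp_d L) @
     enc_mat enc_rat (lbp_A L) @ enc_mat enc_rat (lbp_B L) @ enc_vec enc_rat (lbp_b L) @
     enc_vec enc_rat (lbp_e L) @
     enc_mat enc_rat (lbp_C L) @ enc_mat enc_rat (lbp_D L) @ enc_vec enc_rat (lbp_f L)"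

definition KNAPSACK :: "(int vec \<times> int, int vec) problem" where
  "KNAPSACK = \<lparr> instances = kp_instances,
     solution = (\<lambda>(a, \<delta>) z. kp_optimal a \<delta> (map_vec real_of_int z)),
     enc_inst = enc_kp,
     enc_sol = enc_vec (\<lambda>k. [k]) \<rparr>"

definition BILEVEL :: "(lbp, rat vec \<times> rat vec) problem" where
  "BILEVEL = \<lparr> instances = lbp_instances,
     solution = (\<lambda>L (x, y). lbp_optimal L (rvec x, rvec y)),
     enc_inst = enc_lbp,
     enc_sol = (\<lambda>(x, y). enc_vec enc_rat x @ enc_vec enc_rat y) \<rparr>"

definition inst_size :: "('i, 's) problem \<Rightarrow> 'i \<Rightarrow> nat" where
  "inst_size P J = tape_size (enc_inst P J)"

definition sol_size :: "('i, 's) problem \<Rightarrow> 's \<Rightarrow> nat" where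
  "sol_size P s = tape_size (enc_sol P s)"

text \<open>
  \<open>f\<close> induces a polynomial-time reduction from \<open>P\<close> to \<open>Q\<close>: the instance \<open>f J\<close> is computable in
  time polynomial in the size of \<open>J\<close>; whenever \<open>J\<close> is solvable, \<open>f J\<close> has a solution of polynomial
  size (this excludes vacuous reductions); and one fixed program turns \<open>J\<close> and any solution of
  \<open>f J\<close> into a solution of \<open>J\<close>, in time polynomial in the size of \<open>J\<close> as long as the given solution
  is of size polynomial (with an arbitrary polynomial \<open>q\<close>) in the size of \<open>J\<close>.
\<close>

definition poly_time_reduction ::
    "('i, 's) problem \<Rightarrow> ('j, 't) problem \<Rightarrow> ('i \<Rightarrow> 'j) \<Rightarrow> bool" where
  "poly_time_reduction P Q f \<longleftrightarrow>
     f ` instances P \<subseteq> instances Q \<and>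
     (\<exists>c (p :: nat poly). \<forall>J\<in>instances P.
        computes_within c (enc_inst P J) (enc_inst Q (f J)) (poly p (inst_size P J))) \<and>
     (\<exists>q :: nat poly. \<forall>J\<in>instances P. (\<exists>w. solution P J w) \<longrightarrow>
        (\<exists>s. solution Q (f J) s \<and> sol_size Q s \<le> poly q (inst_size P J))) \<and>
     (\<exists>c. \<forall>q :: nat poly. \<exists>p :: nat poly. \<forall>J\<in>instances P. \<forall>s.
        solution Q (f J) s \<and> sol_size Q s \<le> poly q (inst_size P J) \<longrightarrow>
        (\<exists>w. solution P J w \<and>
           computes_within c (enc_inst P J @ enc_sol Q s) (enc_sol P w) (poly p (inst_size P J))))"

lemma bl_lbp_in_instances: "bl_lbp a \<delta> M \<in> lbp_instances"
proof -
  let ?n = "dim_vec a"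
  have A: "mat_of_rows ?n [map_vec rat_of_int a] @\<^sub>r 1\<^sub>m ?n @\<^sub>r - 1\<^sub>m ?n \<in> carrier_mat (1 + (?n + ?n)) ?n"
    by (intro carrier_append_rows) (auto simp: mat_of_rows_def)
  have b: "vec 1 (\<lambda>_. rat_of_int \<delta>) @\<^sub>v ones_vec ?n @\<^sub>v 0\<^sub>v ?n \<in> carrier_vec (1 + (?n + ?n))"
    by (intro append_carrier_vec) (auto simp: ones_vec_def)
  show ?thesis
    unfolding lbp_instances_def bl_lbp_def Let_def mem_Collect_eq
    apply (rule exI[of _ ?n], rule exI[of _ ?n], rule exI[of _ "1 + (?n + ?n)"],
        rule exI[of _ "?n + (?n + ?n)"])
    using A b by (auto simp: ones_vec_def intro!: carrier_append_rows append_carrier_vec)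
qed

lemma map_mat_append_rows:
  assumes "A \<in> carrier_mat k n" "B \<in> carrier_mat l n"
  shows "rmat (A @\<^sub>r B) = rmat A @\<^sub>r rmat B"
  using assms by (intro eq_matI) (auto simp: append_rows_def)

lemma map_vec_append_vec: "rvec (v @\<^sub>v w) = rvec v @\<^sub>v rvec w"
  by (intro eq_vecI) auto

lemma add_append_vec:
  assumes "u \<in> carrier_vec k" "v \<in> carrier_vec k" "u' \<in> carrier_vec l" "v' \<in> carrier_vec l"
  shows "(u @\<^sub>v u') + (v @\<^sub>v v') = (u + v) @\<^sub>v (u' + v' :: real vec)"
  using assms by (intro eq_vecI) auto

lemma sum_lessThan_eq: "(\<Sum>i<n. f i) = (\<Sum>i = 0..<n. f i)" for f :: "nat \<Rightarrow> real"
  by (simp add: atLeast0LessThan)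

lemma follower_feasible_dim:
  assumes "follower_feasible n x y"
  shows "dim_vec x = n" "dim_vec y = n"
proof -
  have "n = dim_vec y" "dim_vec y = dim_vec x"
    using assms unfolding follower_feasible_def less_eq_vec_def index_zero_vec by blast+
  then show "dim_vec x = n" "dim_vec y = n" by simp_all
qed

lemma bl_feasible_dim:
  assumes "bl_feasible a \<delta> (x, y)"
  shows "dim_vec x = dim_vec a" "dim_vec y = dim_vec a"
  using assms follower_feasible_dim unfolding bl_feasible_def is_arg_max_def prod.case by blast+

lemma lbp_follower_feasible_bl_lbp:
  assumes x: "x \<in> carrier_vec (dim_vec a)"
  shows "lbp_follower_feasible (bl_lbp a \<delta> M) x y \<longleftrightarrow> follower_feasible (dim_vec a) x y"
proof (cases "y \<in> carrier_vec (dim_vec a)")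
  case y: True
  let ?n = "dim_vec a"
  have C: "rmat (- 1\<^sub>m ?n @\<^sub>r 1\<^sub>m ?n @\<^sub>r 0\<^sub>m ?n ?n) = rmat (- 1\<^sub>m ?n) @\<^sub>r rmat (1\<^sub>m ?n) @\<^sub>r rmat (0\<^sub>m ?n ?n)"
    by (subst map_mat_append_rows[of _ ?n ?n _ "?n + ?n"], force, force,
        subst map_mat_append_rows[of _ ?n ?n _ ?n]) auto
  have D: "rmat (1\<^sub>m ?n @\<^sub>r 1\<^sub>m ?n @\<^sub>r - 1\<^sub>m ?n) = rmat (1\<^sub>m ?n) @\<^sub>r rmat (1\<^sub>m ?n) @\<^sub>r rmat (- 1\<^sub>m ?n)"
    by (subst map_mat_append_rows[of _ ?n ?n _ "?n + ?n"], force, force,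
        subst map_mat_append_rows[of _ ?n ?n _ ?n]) auto
  have m1: "rmat (1\<^sub>m ?n) = 1\<^sub>m ?n" "rmat (- 1\<^sub>m ?n) = - 1\<^sub>m ?n" "rmat (0\<^sub>m ?n ?n) = 0\<^sub>m ?n ?n"
    by (auto intro!: eq_matI)
  have neg: "(- 1\<^sub>m ?n) *\<^sub>v v = - v" if "v \<in> carrier_vec ?n" for v :: "real vec"
    using that by (simp add: uminus_mult_mat_vec)
  have Cx: "rmat (- 1\<^sub>m ?n @\<^sub>r 1\<^sub>m ?n @\<^sub>r 0\<^sub>m ?n ?n) *\<^sub>v x = - x @\<^sub>v x @\<^sub>v 0\<^sub>v ?n"
    unfolding C m1 using x
    by (subst mat_mult_append[of _ ?n ?n _ "?n + ?n"], force, force, force,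
        subst mat_mult_append[of _ ?n ?n _ ?n]) (auto simp: neg)
  have Dy: "rmat (1\<^sub>m ?n @\<^sub>r 1\<^sub>m ?n @\<^sub>r - 1\<^sub>m ?n) *\<^sub>v y = y @\<^sub>v y @\<^sub>v - y"
    unfolding D m1 using y
    by (subst mat_mult_append[of _ ?n ?n _ "?n + ?n"], force, force, force,
        subst mat_mult_append[of _ ?n ?n _ ?n]) (auto simp: neg)
  have f: "rvec (0\<^sub>v ?n @\<^sub>v ones_vec ?n @\<^sub>v 0\<^sub>v ?n) = 0\<^sub>v ?n @\<^sub>v ones_vec ?n @\<^sub>v 0\<^sub>v ?n"
    by (auto simp: map_vec_append_vec ones_vec_def intro!: arg_cong2[of _ _ _ _ append_vec])
  have s: "(- x @\<^sub>v x @\<^sub>v 0\<^sub>v ?n) + (y @\<^sub>v y @\<^sub>v - y) = (- x + y) @\<^sub>v (x + y) @\<^sub>v (0\<^sub>v ?n + - y)"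
    using x y by (subst add_append_vec[of _ ?n _ _ "?n + ?n"], force, force, force, force,
        subst add_append_vec[of _ ?n _ _ ?n]) auto
  have "lbp_follower_feasible (bl_lbp a \<delta> M) x y \<longleftrightarrow>
      (- x + y) @\<^sub>v (x + y) @\<^sub>v (0\<^sub>v ?n + - y) \<le> 0\<^sub>v ?n @\<^sub>v ones_vec ?n @\<^sub>v (0\<^sub>v ?n :: real vec)"
    using y unfolding lbp_follower_feasible_def bl_lbp_def Let_def lbp.simps Cx Dy f s by simp
  also have "\<dots> \<longleftrightarrow> - x + y \<le> 0\<^sub>v ?n \<and> x + y \<le> ones_vec ?n \<and> 0\<^sub>v ?n + - y \<le> 0\<^sub>v ?n"
    using x y by (subst append_vec_le[of _ ?n], force, force,
        subst append_vec_le[of _ ?n]) (auto simp: ones_vec_def)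
  also have "\<dots> \<longleftrightarrow> follower_feasible ?n x y"
    using x y by (force simp: follower_feasible_def less_eq_vec_def ones_vec_def)
  finally show ?thesis .
next
  case False
  have "\<not> follower_feasible (dim_vec a) x y"
    using False follower_feasible_dim carrier_vecI by blast
  then show ?thesis
    using False by (auto simp: lbp_follower_feasible_def bl_lbp_def Let_def)
qed

lemma lbp_feasible_bl_lbp: "lbp_feasible (bl_lbp a \<delta> M) p \<longleftrightarrow> bl_feasible a \<delta> p"
proof (cases p)
  case (Pair x y)
  let ?n = "dim_vec a"
  let ?w = "map_vec rat_of_int a"
  show ?thesis
  proof (cases "x \<in> carrier_vec ?n \<and> y \<in> carrier_vec ?n")
    case True
    then have x: "x \<in> carrier_vec ?n" and y: "y \<in> carrier_vec ?n" by auto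
    have A: "rmat (mat_of_rows ?n [?w] @\<^sub>r 1\<^sub>m ?n @\<^sub>r - 1\<^sub>m ?n)
        = rmat (mat_of_rows ?n [?w]) @\<^sub>r rmat (1\<^sub>m ?n) @\<^sub>r rmat (- 1\<^sub>m ?n)"
      by (subst map_mat_append_rows[of _ 1 ?n _ "?n + ?n"], force simp: mat_of_rows_def, force,
          subst map_mat_append_rows[of _ ?n ?n _ ?n]) auto
    have m1: "rmat (1\<^sub>m ?n) = 1\<^sub>m ?n" "rmat (- 1\<^sub>m ?n) = - 1\<^sub>m ?n" "rmat (0\<^sub>m k ?n) = 0\<^sub>m k ?n" for k
      by (auto intro!: eq_matI)
    have neg: "(- 1\<^sub>m ?n) *\<^sub>v v = - v" if "v \<in> carrier_vec ?n" for v :: "real vec"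
      using that by (simp add: uminus_mult_mat_vec)
    have w: "rmat (mat_of_rows ?n [?w]) *\<^sub>v x = vec 1 (\<lambda>_. weight a x)"
      using x by (intro eq_vecI)
        (auto simp: mat_of_rows_def weight_def scalar_prod_def sum_lessThan_eq)
    have Ax: "rmat (mat_of_rows ?n [?w] @\<^sub>r 1\<^sub>m ?n @\<^sub>r - 1\<^sub>m ?n) *\<^sub>v x
        = vec 1 (\<lambda>_. weight a x) @\<^sub>v x @\<^sub>v - x"
      unfolding A using x
      by (subst mat_mult_append[of _ 1 ?n _ "?n + ?n"], force simp: mat_of_rows_def, force, force,
          subst mat_mult_append[of _ ?n ?n _ ?n]) (auto simp: neg m1 w)
    have By: "rmat (0\<^sub>m (1 + (?n + ?n)) ?n) *\<^sub>v y = 0\<^sub>v (1 + (?n + ?n))"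
      unfolding m1 using y by (intro eq_vecI) auto
    have z: "(vec 1 (\<lambda>_. weight a x) @\<^sub>v x @\<^sub>v - x) + 0\<^sub>v (1 + (?n + ?n))
        = vec 1 (\<lambda>_. weight a x) @\<^sub>v x @\<^sub>v - x"
      by (rule right_zero_vec, intro append_carrier_vec) (use x in auto)
    have b: "rvec (vec 1 (\<lambda>_. rat_of_int \<delta>) @\<^sub>v ones_vec ?n @\<^sub>v 0\<^sub>v ?n)
        = vec 1 (\<lambda>_. real_of_int \<delta>) @\<^sub>v ones_vec ?n @\<^sub>v 0\<^sub>v ?n"
      by (auto simp: map_vec_append_vec ones_vec_def intro!: arg_cong2[of _ _ _ _ append_vec])
    have "vec 1 (\<lambda>_. weight a x) @\<^sub>v x @\<^sub>v - x \<le> vec 1 (\<lambda>_. real_of_int \<delta>) @\<^sub>v ones_vec ?n @\<^sub>v 0\<^sub>v ?n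
        \<longleftrightarrow> vec 1 (\<lambda>_. weight a x) \<le> vec 1 (\<lambda>_. real_of_int \<delta>) \<and> x \<le> ones_vec ?n \<and> - x \<le> 0\<^sub>v ?n"
      using x by (subst append_vec_le[of _ 1], force, force,
          subst append_vec_le[of _ ?n]) (auto simp: ones_vec_def)
    also have "\<dots> \<longleftrightarrow> weight a x \<le> real_of_int \<delta> \<and> 0\<^sub>v ?n \<le> x \<and> x \<le> ones_vec ?n"
      using x by (auto simp: less_eq_vec_def ones_vec_def)
    finally have lead: "rmat (lbp_A (bl_lbp a \<delta> M)) *\<^sub>v x + rmat (lbp_B (bl_lbp a \<delta> M)) *\<^sub>v y
          \<le> rvec (lbp_b (bl_lbp a \<delta> M))
        \<longleftrightarrow> weight a x \<le> real_of_int \<delta> \<and> 0\<^sub>v ?n \<le> x \<and> x \<le> ones_vec ?n"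
      unfolding bl_lbp_def Let_def lbp.simps Ax By z b .
    have fol: "lbp_follower_feasible (bl_lbp a \<delta> M) x = follower_feasible ?n x"
      using lbp_follower_feasible_bl_lbp[OF x] by blast
    have e: "rvec (lbp_e (bl_lbp a \<delta> M)) \<bullet> y' = (\<Sum>i<?n. y' $ i)"
      if "follower_feasible ?n x y'" for y'
      unfolding scalar_prod_def sum_lessThan_eq follower_feasible_dim(2)[OF that]
      by (rule sum.cong) (auto simp: bl_lbp_def Let_def ones_vec_def)
    have arg: "is_arg_max (\<lambda>y'. rvec (lbp_e (bl_lbp a \<delta> M)) \<bullet> y') (follower_feasible ?n x) y
        \<longleftrightarrow> is_arg_max (\<lambda>y'. \<Sum>i<?n. y' $ i) (follower_feasible ?n x) y"
      unfolding is_arg_max_def using e by metis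
    show ?thesis
      unfolding Pair lbp_feasible_def bl_feasible_def prod.case lead fol arg
      using x y by (simp add: bl_lbp_def Let_def)
  next
    case False
    have "\<not> bl_feasible a \<delta> (x, y)"
      using False bl_feasible_dim carrier_vecI by blast
    moreover have "\<not> lbp_feasible (bl_lbp a \<delta> M) (x, y)"
      using False by (auto simp: lbp_feasible_def bl_lbp_def Let_def)
    ultimately show ?thesis unfolding Pair by blast
  qed
qed

lemma lbp_objective_bl_lbp:
  assumes "bl_feasible a \<delta> p"
  shows "lbp_objective (bl_lbp a \<delta> M) p = bl_objective a (real_of_int M) p"
proof (cases p)
  case (Pair x y)
  then have d: "dim_vec x = dim_vec a" "dim_vec y = dim_vec a"
    using assms bl_feasible_dim by blast+
  have c: "rvec (lbp_c (bl_lbp a \<delta> M)) \<bullet> x = weight a x"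
    unfolding scalar_prod_def weight_def d sum_lessThan_eq
    by (rule sum.cong) (auto simp: bl_lbp_def Let_def)
  have "rvec (lbp_d (bl_lbp a \<delta> M)) \<bullet> y = (\<Sum>i<dim_vec a. - real_of_int M * y $ i)"
    unfolding scalar_prod_def d sum_lessThan_eq
    by (rule sum.cong) (auto simp: bl_lbp_def Let_def of_rat_minus)
  also have "\<dots> = - real_of_int M * (\<Sum>i<dim_vec a. y $ i)"
    by (rule sum_distrib_left[symmetric])
  finally show ?thesis
    unfolding Pair lbp_objective_def bl_objective_def prod.case c by simp
qed

lemma lbp_optimal_bl_lbp: "lbp_optimal (bl_lbp a \<delta> M) p \<longleftrightarrow> bl_optimal a \<delta> (real_of_int M) p"
  unfolding lbp_optimal_def bl_optimal_def is_arg_max_def lbp_feasible_bl_lbp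
  using lbp_objective_bl_lbp by metis

end

theory Submission
  imports Defs
begin

text \<open>
  The follower's optimum is \<open>y i = min (x i) (1 - x i)\<close>. Let \<open>\<beta>\<close> be the largest entry and let \<open>S\<close> be
  the set of coordinates with \<open>x i > 1/2\<close>. If \<open>S\<close> fits into the knapsack, rounding to the nearest
  integer improves every fractional coordinate, because \<open>M > \<beta>\<close>. Otherwise
  \<open>(\<Sum>i\<in>S. a i) \<ge> \<delta> + 1\<close> by integrality, so \<open>(\<Sum>i\<in>S. a i * (1 - x i)) \<ge> 1\<close>; hence the penalty exceeds
  \<open>M / \<beta> > \<beta>\<close> and the objective is below \<open>\<delta> - \<beta>\<close>, whereas dropping items from \<open>S\<close> one at a time
  stops at a weight above \<open>\<delta> - \<beta>\<close>.

  For the reduction, one program writes out the data of the bilevel problem in nested loops over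
  the items. Solutions are read back by copying the numerators of \<open>x\<close>, whose denominators are all
  \<open>1\<close>. All numbers that occur have size linear in the size of the instance.
\<close>

section \<open>Optimal solutions of the bilevel problem\<close>

text \<open>Elements leave \<open>S\<close> one at a time. The removal that first brings the sum
  down to at most \<open>\<delta>\<close> starts above \<open>\<delta>\<close> and takes away at
  most \<open>\<beta>\<close>. It happens at the latest when the set becomes empty, because
  \<open>0 \<le> \<delta>\<close>.\<close>

lemma exists_subset_sum_near:
  fixes a :: "'i \<Rightarrow> int"
  assumes "finite S" "\<forall>i\<in>S. a i \<le> \<beta>" "0 \<le> \<delta>" "\<delta> < sum a S"
  shows "\<exists>T\<subseteq>S. sum a T \<le> \<delta> \<and> \<delta> - \<beta> < sum a T"
  using assms
proof (induction S rule: finite_induct)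
  case empty
  then show ?case by simp
next
  case (insert i S)
  show ?case
  proof (cases "\<delta> < sum a S")
    case True
    with insert obtain T where "T \<subseteq> S" "sum a T \<le> \<delta>" "\<delta> - \<beta> < sum a T" by auto
    then show ?thesis by blast
  next
    case False
    with insert have "sum a S \<le> \<delta>" "\<delta> - \<beta> < sum a S" by auto
    then show ?thesis by blast
  qed
qed

definition indicator_vec :: "nat \<Rightarrow> nat set \<Rightarrow> real vec" where
  "indicator_vec n S = vec n (\<lambda>i. if i \<in> S then 1 else 0)"

lemma binary_indicator_vec: "binary_vec n (indicator_vec n S)"
  by (auto simp: binary_vec_def indicator_vec_def)

lemma weight_indicator_vec:
  assumes "S \<subseteq> {..<dim_vec a}"
  shows "weight a (indicator_vec (dim_vec a) S) = real_of_int (\<Sum>i\<in>S. a $ i)"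
proof -
  have "weight a (indicator_vec (dim_vec a) S) = (\<Sum>i<dim_vec a. if i \<in> S then real_of_int (a $ i) else 0)"
    unfolding weight_def by (rule sum.cong) (auto simp: indicator_vec_def)
  also have "\<dots> = (\<Sum>i\<in>{..<dim_vec a} \<inter> S. real_of_int (a $ i))"
    by (simp add: sum.inter_restrict)
  also have "{..<dim_vec a} \<inter> S = S" using assms by blast
  finally show ?thesis by simp
qed

section \<open>The follower's best response\<close>

lemma follower_feasible_iff:
  "follower_feasible n x y \<longleftrightarrow> dim_vec x = n \<and> dim_vec y = n \<and>
     (\<forall>i<n. 0 \<le> y $ i \<and> y $ i \<le> x $ i \<and> y $ i \<le> 1 - x $ i)"
  by (auto simp: follower_feasible_def less_eq_vec_def ones_vec_def)

text \<open>The follower's constraints decouple over the coordinates, so the vector of minima is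
  feasible and dominates every feasible point componentwise. Under such domination equal sums force
  equal vectors, which gives uniqueness.\<close>

lemma follower_optimal_iff:
  assumes x: "dim_vec x = n" "\<forall>i<n. 0 \<le> x $ i \<and> x $ i \<le> 1"
  shows "is_arg_max (\<lambda>y'. \<Sum>i<n. y' $ i) (follower_feasible n x) y \<longleftrightarrow>
    y = vec n (\<lambda>i. min (x $ i) (1 - x $ i))"
    (is "is_arg_max ?s _ y \<longleftrightarrow> y = ?m")
proof -
  have m: "follower_feasible n x ?m"
    using x by (auto simp: follower_feasible_iff)
  have le: "y' $ i \<le> ?m $ i" if "follower_feasible n x y'" "i < n" for y' i
    using that by (auto simp: follower_feasible_iff)
  show ?thesis
  proof
    assume opt: "is_arg_max ?s (follower_feasible n x) y"
    then have y: "follower_feasible n x y" and "\<not> ?s y < ?s ?m"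
      using m by (auto simp: is_arg_max_def)
    have "?s y \<le> ?s ?m"
      by (rule sum_mono) (use le[OF y] in simp)
    with \<open>\<not> ?s y < ?s ?m\<close> have eq: "?s y = ?s ?m" by linarith
    have "y $ i = ?m $ i" if "i < n" for i
    proof (rule ccontr)
      assume "y $ i \<noteq> ?m $ i"
      with le[OF y that] have "y $ i < ?m $ i" by linarith
      then have "?s y < ?s ?m"
        by (intro sum_strict_mono_ex1) (use le[OF y] that in auto)
      with eq show False by simp
    qed
    then show "y = ?m"
      using y by (intro eq_vecI) (auto simp: follower_feasible_iff)
  next
    assume "y = ?m"
    moreover have "?s y' \<le> ?s ?m" if "follower_feasible n x y'" for y'
      by (rule sum_mono) (use le[OF that] in simp)
    ultimately show "is_arg_max ?s (follower_feasible n x) y"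
      using m by (auto simp: is_arg_max_def not_less)
  qed
qed

text \<open>Replaces the inner argmax by its unique point, so that feasibility becomes a statement
  about \<open>x\<close> and an explicit \<open>y\<close>.\<close>

lemma bl_feasible_iff:
  "bl_feasible a \<delta> (x, y) \<longleftrightarrow>
    weight a x \<le> real_of_int \<delta> \<and> dim_vec x = dim_vec a \<and>
    (\<forall>i<dim_vec a. 0 \<le> x $ i \<and> x $ i \<le> 1) \<and>
    y = vec (dim_vec a) (\<lambda>i. min (x $ i) (1 - x $ i))"
  (is "?l \<longleftrightarrow> ?r")
proof -
  have box: "0\<^sub>v (dim_vec a) \<le> x \<and> x \<le> ones_vec (dim_vec a) \<longleftrightarrow>
      dim_vec x = dim_vec a \<and> (\<forall>i<dim_vec a. 0 \<le> x $ i \<and> x $ i \<le> 1)"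
    by (auto simp: less_eq_vec_def ones_vec_def)
  show ?thesis
    unfolding bl_feasible_def prod.case using box follower_optimal_iff by blast
qed

text \<open>\<open>min t (1 - t)\<close> vanishes exactly at \<open>t = 0\<close> and
  \<open>t = 1\<close>, so a zero response of the follower marks the binary points.\<close>

lemma kp_feasible_iff_bl_feasible:
  "kp_feasible a \<delta> z \<longleftrightarrow> integer_vec z \<and> bl_feasible a \<delta> (z, 0\<^sub>v (dim_vec a))"
proof
  assume z: "kp_feasible a \<delta> z"
  then have d: "dim_vec z = dim_vec a" and b: "z $ i = 0 \<or> z $ i = 1" if "i < dim_vec a" for i
    using that by (auto simp: kp_feasible_def binary_vec_def)
  have "integer_vec z"
    using z unfolding kp_feasible_def binary_vec_def integer_vec_def by fastforce
  moreover have "0\<^sub>v (dim_vec a) = vec (dim_vec a) (\<lambda>i. min (z $ i) (1 - z $ i))"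
    by (intro eq_vecI) (use b in fastforce)+
  ultimately show "integer_vec z \<and> bl_feasible a \<delta> (z, 0\<^sub>v (dim_vec a))"
    using z unfolding bl_feasible_iff kp_feasible_def binary_vec_def by fastforce
next
  assume z: "integer_vec z \<and> bl_feasible a \<delta> (z, 0\<^sub>v (dim_vec a))"
  have "z $ i = 0 \<or> z $ i = 1" if "i < dim_vec a" for i
  proof -
    have "0\<^sub>v (dim_vec a) = vec (dim_vec a) (\<lambda>i. min (z $ i) (1 - z $ i))"
      using z unfolding bl_feasible_iff by blast
    then have "0\<^sub>v (dim_vec a) $ i = vec (dim_vec a) (\<lambda>i. min (z $ i) (1 - z $ i)) $ i"
      by (rule arg_cong)
    then have "0 = min (z $ i) (1 - z $ i)"
      using that by simp
    then show ?thesis by (auto simp: min_def split: if_splits)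
  qed
  then show "kp_feasible a \<delta> z"
    using z unfolding bl_feasible_iff kp_feasible_def binary_vec_def by (auto intro: carrier_vecI)
qed

text \<open>An integer in the unit interval is one of its endpoints, and there the response of the
  follower is \<open>0\<close>.\<close>

lemma bl_feasible_integer:
  assumes "bl_feasible a \<delta> (x, y)" "integer_vec x"
  shows "y = 0\<^sub>v (dim_vec a)" "kp_feasible a \<delta> x"
proof -
  have "min (x $ i) (1 - x $ i) = 0" if i: "i < dim_vec a" for i
  proof -
    have "x $ i \<in> \<int>" "0 \<le> x $ i" "x $ i \<le> 1"
      using assms i by (auto simp: bl_feasible_iff integer_vec_def)
    then obtain k where k: "x $ i = of_int k" by (auto elim: Ints_cases)
    with \<open>0 \<le> x $ i\<close> \<open>x $ i \<le> 1\<close> have "k = 0 \<or> k = 1" by auto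
    with k show ?thesis by auto
  qed
  then show y: "y = 0\<^sub>v (dim_vec a)"
    using assms unfolding bl_feasible_iff by (intro eq_vecI) auto
  show "kp_feasible a \<delta> x"
    using assms unfolding y kp_feasible_iff_bl_feasible by simp
qed

section \<open>Domination of fractional points and integrality of optima\<close>

lemma bl_objective_zero: "bl_objective a M (z, 0\<^sub>v (dim_vec a)) = weight a z"
  by (simp add: bl_objective_def)

lemma max_entry_ge:
  assumes "i < dim_vec a"
  shows "a $ i \<le> max_entry a"
  using assms by (auto simp: max_entry_def)

text \<open>The witness is the rounding of \<open>x\<close> or, if that is too heavy, a subset of
  its support. In the first case the comparison is made coordinate by coordinate, in the second
  through the total penalty.\<close>

lemma fractional_dominated:
  assumes inst: "(a, \<delta>) \<in> kp_instances" and M: "(real_of_int (max_entry a))\<^sup>2 < M"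
    and feas: "bl_feasible a \<delta> (x, y)" and frac: "\<not> integer_vec x"
  shows "\<exists>z. kp_feasible a \<delta> z \<and> bl_objective a M (x, y) < weight a z"
proof -
  define n where "n = dim_vec a"
  define \<beta> where "\<beta> = max_entry a"
  define S where "S = {i. i < n \<and> 1 / 2 < x $ i}"
  have S: "S \<subseteq> {..<n}" "finite S" by (auto simp: S_def)
  have a: "0 < a $ i" "a $ i \<le> \<beta>" if "i < n" for i
    using inst that max_entry_ge by (auto simp: kp_instances_def n_def \<beta>_def)
  have \<beta>: "2 \<le> \<beta>" and \<delta>: "0 < \<delta>" using inst by (auto simp: kp_instances_def \<beta>_def)
  have x: "0 \<le> x $ i" "x $ i \<le> 1" if "i < n" for i
    using feas that by (auto simp: bl_feasible_iff n_def)
  have y: "y $ i = min (x $ i) (1 - x $ i)" if "i < n" for i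
    using feas that by (auto simp: bl_feasible_iff n_def)
  have xd: "dim_vec x = n" and cap: "(\<Sum>i<n. a $ i * x $ i) \<le> \<delta>"
    using feas by (auto simp: bl_feasible_iff n_def weight_def)
  have ra: "0 < real_of_int (a $ i)" "real_of_int (a $ i) \<le> \<beta>" if "i < n" for i
    using a[OF that] by auto
  have "real_of_int \<beta> * 1 \<le> (real_of_int \<beta>)\<^sup>2"
    unfolding power2_eq_square using \<beta> by (intro mult_left_mono) auto
  \<comment> \<open>Rounding works with this weaker bound; the full strength of
    \<open>M > \<beta>^2\<close> enters in the second case.\<close>
  then have M\<beta>: "\<beta> < M" using M unfolding \<beta>_def by linarith
  have obj: "bl_objective a M (x, y) = (\<Sum>i<n. a $ i * x $ i) - M * (\<Sum>i<n. y $ i)"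
    by (simp add: bl_objective_def weight_def n_def)
  show ?thesis
  proof (cases "(\<Sum>i\<in>S. a $ i) \<le> \<delta>")
    case True
    let ?z = "indicator_vec n S"
    \<comment> \<open>On \<open>S\<close>, rounding up adds weight and saves the penalty. Off
      \<open>S\<close> the response equals \<open>x i\<close>, so the penalty \<open>M * x i\<close>
      outweighs the lost \<open>a i * x i\<close>.\<close>
    have le: "a $ i * x $ i - M * y $ i \<le> a $ i * ?z $ i" if i: "i < n" for i
    proof (cases "i \<in> S")
      case True
      have "a $ i * x $ i \<le> real_of_int (a $ i) * 1" by (rule mult_left_mono) (use ra[OF i] x[OF i] in auto)
      moreover have "0 \<le> M * y $ i" using y[OF i] x[OF i] M\<beta> \<beta> by auto
      ultimately show ?thesis using True i by (simp add: indicator_vec_def)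
    next
      case False
      then have "y $ i = x $ i" using y[OF i] i by (auto simp: S_def)
      moreover have "a $ i * x $ i \<le> M * x $ i"
        by (rule mult_right_mono) (use ra[OF i] x[OF i] M\<beta> in auto)
      ultimately show ?thesis using False i by (simp add: indicator_vec_def)
    qed
    \<comment> \<open>A single fractional coordinate makes the summed comparison strict.\<close>
    obtain j where j: "j < n" "x $ j \<notin> \<int>"
      using frac xd by (auto simp: integer_vec_def)
    then have j01: "0 < x $ j" "x $ j < 1"
      using x[OF j(1)] by (metis Ints_0 order_less_le, metis Ints_1 order_less_le)
    have less: "a $ j * x $ j - M * y $ j < a $ j * ?z $ j"
    proof (cases "j \<in> S")
      case True
      have "a $ j * x $ j < real_of_int (a $ j) * 1"
        using ra[OF j(1)] j01 by (intro mult_strict_left_mono) auto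
      moreover have "0 \<le> M * y $ j" using y[OF j(1)] j01 M\<beta> \<beta> by auto
      ultimately show ?thesis using True j by (simp add: indicator_vec_def)
    next
      case False
      then have "y $ j = x $ j" using y[OF j(1)] j by (auto simp: S_def)
      moreover have "a $ j * x $ j < M * x $ j"
        using ra[OF j(1)] j01 M\<beta> by (intro mult_strict_right_mono) auto
      ultimately show ?thesis using False j by (simp add: indicator_vec_def)
    qed
    have "bl_objective a M (x, y) = (\<Sum>i<n. a $ i * x $ i - M * y $ i)"
      unfolding obj by (simp add: sum_subtractf sum_distrib_left)
    also have "\<dots> < (\<Sum>i<n. a $ i * ?z $ i)"
      by (rule sum_strict_mono_ex1) (use le less j in auto)
    also have "\<dots> = weight a ?z" by (simp add: weight_def n_def)
    finally have "bl_objective a M (x, y) < weight a ?z" .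
    moreover have "kp_feasible a \<delta> ?z"
      using True S binary_indicator_vec
      by (simp add: kp_feasible_def n_def weight_indicator_vec del: of_int_sum)
    ultimately show ?thesis by blast
  next
    case False
    then obtain T where T: "T \<subseteq> S" "(\<Sum>i\<in>T. a $ i) \<le> \<delta>" "\<delta> - \<beta> < (\<Sum>i\<in>T. a $ i)"
      using exists_subset_sum_near[of S "\<lambda>i. a $ i" \<beta> \<delta>] S a \<delta> by auto
    let ?z = "indicator_vec n T"
    have wz: "weight a ?z = real_of_int (\<Sum>i\<in>T. a $ i)"
      unfolding n_def by (rule weight_indicator_vec) (use T S n_def in auto)
    have "(\<Sum>i\<in>S. a $ i * x $ i) \<le> (\<Sum>i<n. a $ i * x $ i)"
    proof (rule sum_mono2)
      show "0 \<le> a $ i * x $ i" if "i \<in> {..<n} - S" for i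
        using that ra[of i] x[of i] by auto
    qed (use S in auto)
    with cap have "(\<Sum>i\<in>S. a $ i * x $ i) \<le> \<delta>" by linarith
    \<comment> \<open>Integer weights: the rounded point overshoots \<open>\<delta>\<close> by a
      full unit, whereas \<open>x\<close> restricted to \<open>S\<close> stays within
      \<open>\<delta>\<close>. The gap between the two is the sum of \<open>a i * (1 - x i)\<close>
      over \<open>S\<close>.\<close>
    moreover have "\<delta> + 1 \<le> (\<Sum>i\<in>S. a $ i)" using False by linarith
    then have "real_of_int (\<delta> + 1) \<le> real_of_int (\<Sum>i\<in>S. a $ i)" by (simp only: of_int_le_iff)
    moreover have "(\<Sum>i\<in>S. a $ i * (1 - x $ i)) = real_of_int (\<Sum>i\<in>S. a $ i) - (\<Sum>i\<in>S. a $ i * x $ i)"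
      by (simp add: algebra_simps sum_subtractf)
    ultimately have "1 \<le> (\<Sum>i\<in>S. a $ i * (1 - x $ i))" by simp
    also have "\<dots> \<le> (\<Sum>i\<in>S. \<beta> * (1 - x $ i))"
      by (rule sum_mono, rule mult_right_mono) (use ra x S in auto)
    \<comment> \<open>On \<open>S\<close> the response is \<open>1 - x i\<close>, since there
      \<open>x i > 1/2\<close>.\<close>
    also have "\<dots> = \<beta> * (\<Sum>i\<in>S. y $ i)"
      unfolding sum_distrib_left by (rule sum.cong) (auto simp: y S_def)
    also have "\<dots> \<le> \<beta> * (\<Sum>i<n. y $ i)"
      using \<beta> S x by (intro mult_left_mono sum_mono2) (auto simp: y)
    finally have e: "1 \<le> \<beta> * (\<Sum>i<n. y $ i)" .
    \<comment> \<open>Strict positivity keeps the inequality strict when \<open>\<beta>^2\<close> is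
      replaced by \<open>M\<close> below.\<close>
    have pos: "0 < (\<Sum>i<n. y $ i)"
    proof (rule ccontr)
      assume "\<not> 0 < (\<Sum>i<n. y $ i)"
      then have "\<beta> * (\<Sum>i<n. y $ i) \<le> 0" using \<beta> by (intro mult_nonneg_nonpos) auto
      with e show False by linarith
    qed
    have "real_of_int \<beta> * 1 \<le> \<beta> * (\<beta> * (\<Sum>i<n. y $ i))"
      using e \<beta> by (intro mult_left_mono) auto
    also have "\<dots> = (real_of_int \<beta>)\<^sup>2 * (\<Sum>i<n. y $ i)" by (simp add: power2_eq_square)
    also have "\<dots> < M * (\<Sum>i<n. y $ i)"
      using M pos by (intro mult_strict_right_mono) (auto simp: \<beta>_def)
    finally have "bl_objective a M (x, y) < real_of_int (\<delta> - \<beta>)" using cap unfolding obj by simp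
    also have "\<dots> < real_of_int (\<Sum>i\<in>T. a $ i)" using T(3) by (simp only: of_int_less_iff)
    also have "\<dots> = weight a ?z" using wz by (rule sym)
    finally have "bl_objective a M (x, y) < weight a ?z" .
    moreover have "kp_feasible a \<delta> ?z"
      using T(2) wz binary_indicator_vec by (simp add: kp_feasible_def n_def del: of_int_sum)
    ultimately show ?thesis by blast
  qed
qed

text \<open>A fractional optimum would be beaten by some feasible \<open>(z, 0)\<close>. On integer
  feasible points the penalty is zero and the objective is the knapsack weight, so optimality
  carries over.\<close>

lemma bl_optimal_integer:
  assumes inst: "(a, \<delta>) \<in> kp_instances" and M: "(real_of_int (max_entry a))\<^sup>2 < M"
    and opt: "bl_optimal a \<delta> M (x, y)"
  shows "integer_vec x" "y = 0\<^sub>v (dim_vec a)" "kp_optimal a \<delta> x"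
proof -
  have feas: "bl_feasible a \<delta> (x, y)"
    and max: "\<And>p. bl_feasible a \<delta> p \<Longrightarrow> bl_objective a M p \<le> bl_objective a M (x, y)"
    using opt by (auto simp: bl_optimal_def is_arg_max_def not_less)
  have maxz: "weight a z \<le> bl_objective a M (x, y)" if "kp_feasible a \<delta> z" for z
    using max[of "(z, 0\<^sub>v (dim_vec a))"] that
    by (simp add: kp_feasible_iff_bl_feasible bl_objective_zero)
  show int: "integer_vec x"
    using fractional_dominated[OF inst M feas] maxz by force
  show y: "y = 0\<^sub>v (dim_vec a)" and "kp_optimal a \<delta> x"
    using bl_feasible_integer[OF feas int] maxz
    by (auto simp: kp_optimal_def is_arg_max_def not_less bl_objective_zero)
qed

text \<open>The converse direction supplies a solution of the bilevel instance for the reduction.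
  Fractional competitors lie below some binary point, which in turn lies below
  \<open>z\<close>.\<close>

lemma kp_optimal_bl_optimal:
  assumes inst: "(a, \<delta>) \<in> kp_instances" and M: "(real_of_int (max_entry a))\<^sup>2 < M"
    and opt: "kp_optimal a \<delta> z"
  shows "bl_optimal a \<delta> M (z, 0\<^sub>v (dim_vec a))"
proof -
  have z: "kp_feasible a \<delta> z"
    and max: "\<And>z'. kp_feasible a \<delta> z' \<Longrightarrow> weight a z' \<le> weight a z"
    using opt by (auto simp: kp_optimal_def is_arg_max_def not_less)
  have "bl_objective a M (x, y) \<le> weight a z" if feas: "bl_feasible a \<delta> (x, y)" for x y
  proof (cases "integer_vec x")
    case True
    from bl_feasible_integer[OF feas this] max show ?thesis by (simp add: bl_objective_zero)
  next
    case False
    from fractional_dominated[OF inst M feas this] max show ?thesis by fastforce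
  qed
  then show ?thesis
    using z by (auto simp: bl_optimal_def is_arg_max_def not_less bl_objective_zero
        kp_feasible_iff_bl_feasible)
qed

section \<open>Encoding of the bilevel problem\<close>

text \<open>The encoding of integers as rationals: each numerator is followed by the denominator
  \<open>1\<close>.\<close>

definition entries :: "nat \<Rightarrow> (nat \<Rightarrow> int) \<Rightarrow> int list" where
  "entries n f = concat (map (\<lambda>j. [f j, 1]) [0..<n])"

text \<open>The identity, its negative and the zero matrix all have one value on the diagonal and
  one value off it, so a single writing program can serve all three.\<close>

definition diagonal_entries :: "nat \<Rightarrow> int \<Rightarrow> int \<Rightarrow> int list" where
  "diagonal_entries n k l = concat (map (\<lambda>i. entries n (\<lambda>j. if i = j then k else l)) [0..<n])"

lemma enc_rat_of_int: "enc_rat (rat_of_int k) = [k, 1]"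
  by (simp add: enc_rat_def)

lemma enc_rat_vec: "concat (map enc_rat (list_of_vec (vec n (\<lambda>i. rat_of_int (f i))))) = entries n f"
  by (simp add: entries_def comp_def enc_rat_of_int)

lemma rows_append_rows:
  assumes "A \<in> carrier_mat k n" "B \<in> carrier_mat l n"
  shows "rows (A @\<^sub>r B) = rows A @ rows B"
proof (rule nth_equalityI)
  show "length (rows (A @\<^sub>r B)) = length (rows A @ rows B)"
    using assms by (simp add: append_rows_def)
  fix i assume "i < length (rows (A @\<^sub>r B))"
  then show "rows (A @\<^sub>r B) ! i = (rows A @ rows B) ! i"
    using assms by (auto simp: append_rows_def nth_append intro!: eq_vecI)
qed

text \<open>The encoding of a matrix without its two leading dimensions; this part is additive when
  blocks are stacked.\<close>

definition mat_entries :: "rat mat \<Rightarrow> int list" where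
  "mat_entries A = concat (map (\<lambda>r. concat (map enc_rat (list_of_vec r))) (rows A))"

lemma enc_mat_eq:
  assumes "A \<in> carrier_mat k n"
  shows "enc_mat enc_rat A = int k # int n # mat_entries A"
  using assms by (simp add: enc_mat_def mat_entries_def)

lemma mat_entries_append_rows:
  assumes "A \<in> carrier_mat k n" "B \<in> carrier_mat l n"
  shows "mat_entries (A @\<^sub>r B) = mat_entries A @ mat_entries B"
  by (simp add: mat_entries_def rows_append_rows[OF assms])

lemma mat_entries_row:
  "mat_entries (mat_of_rows n [vec n (\<lambda>i. rat_of_int (f i))]) = entries n f"
  using enc_rat_vec[of n f] by (simp add: mat_entries_def)

lemma mat_entries_diagonal:
  "mat_entries (mat n n (\<lambda>(i, j). if i = j then rat_of_int k else rat_of_int l)) = diagonal_entries n k l"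
proof -
  have "row (mat n n (\<lambda>(i, j). if i = j then rat_of_int k else rat_of_int l)) i =
      vec n (\<lambda>j. rat_of_int (if i = j then k else l))" if "i < n" for i
    using that by (intro eq_vecI) auto
  then have "rows (mat n n (\<lambda>(i, j). if i = j then rat_of_int k else rat_of_int l)) =
      map (\<lambda>i. vec n (\<lambda>j. rat_of_int (if i = j then k else l))) [0..<n]"
    unfolding rows_def by (simp add: map_eq_conv)
  then show ?thesis
    unfolding mat_entries_def diagonal_entries_def by (simp only: map_map comp_def enc_rat_vec)
qed

lemma mat_entries_special:
  "mat_entries (1\<^sub>m n) = diagonal_entries n 1 0"
  "mat_entries (- 1\<^sub>m n) = diagonal_entries n (- 1) 0"
  "mat_entries (0\<^sub>m n n) = diagonal_entries n 0 0"
proof -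
  have "1\<^sub>m n = mat n n (\<lambda>(i, j). if i = j then rat_of_int 1 else rat_of_int 0)"
    "- 1\<^sub>m n = mat n n (\<lambda>(i, j). if i = j then rat_of_int (- 1) else rat_of_int 0)"
    "0\<^sub>m n n = mat n n (\<lambda>(i, j). if i = j then rat_of_int 0 else rat_of_int 0)"
    by (auto intro!: eq_matI)
  then show "mat_entries (1\<^sub>m n) = diagonal_entries n 1 0"
    "mat_entries (- 1\<^sub>m n) = diagonal_entries n (- 1) 0"
    "mat_entries (0\<^sub>m n n) = diagonal_entries n 0 0"
    by (simp_all only: mat_entries_diagonal)
qed

text \<open>The encoding is cut into pieces that match the subprograms of
  \<open>output_program\<close> one for one, so that \<open>emits_foldr_Seq\<close> applies.\<close>

lemma enc_lbp_bl_lbp: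
  fixes a :: "int vec" and \<delta> M :: int
  defines "n \<equiv> dim_vec a"
  shows "enc_lbp (bl_lbp a \<delta> M) = concat
    [[int n], entries n (\<lambda>i. a $ i),
     [int n], entries n (\<lambda>_. - M),
     [2 * int n + 1], [int n], entries n (\<lambda>i. a $ i), diagonal_entries n 1 0, diagonal_entries n (- 1) 0,
     [2 * int n + 1], [int n], entries n (\<lambda>_. 0), diagonal_entries n 0 0, diagonal_entries n 0 0,
     [2 * int n + 1], [\<delta>, 1], entries n (\<lambda>_. 1), entries n (\<lambda>_. 0),
     [int n], entries n (\<lambda>_. 1),
     [3 * int n], [int n], diagonal_entries n (- 1) 0, diagonal_entries n 1 0, diagonal_entries n 0 0,
     [3 * int n], [int n], diagonal_entries n 1 0, diagonal_entries n 1 0, diagonal_entries n (- 1) 0,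
     [3 * int n], entries n (\<lambda>_. 0), entries n (\<lambda>_. 1), entries n (\<lambda>_. 0)]"
proof -
  let ?w = "map_vec rat_of_int a"
  have w: "?w = vec n (\<lambda>i. rat_of_int (a $ i))" by (intro eq_vecI) (auto simp: n_def)
  have z: "0\<^sub>v n = vec n (\<lambda>i. rat_of_int 0)" by (intro eq_vecI) auto
  have o: "ones_vec n = vec n (\<lambda>i. rat_of_int 1)" by (simp add: ones_vec_def)
  have c: "enc_vec enc_rat ?w = int n # entries n (\<lambda>i. a $ i)"
    unfolding w enc_vec_def enc_rat_vec by simp
  have d: "enc_vec enc_rat (vec n (\<lambda>_. - rat_of_int M)) = int n # entries n (\<lambda>_. - M)"
    using enc_rat_vec[of n "\<lambda>_. - M"] by (simp add: enc_vec_def)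
  have e: "enc_vec enc_rat (ones_vec n :: rat vec) = int n # entries n (\<lambda>_. 1)"
    unfolding o enc_vec_def enc_rat_vec by simp
  have "enc_vec enc_rat (vec 1 (\<lambda>_. rat_of_int \<delta>) @\<^sub>v ones_vec n @\<^sub>v 0\<^sub>v n) =
      int (1 + (n + n)) # entries 1 (\<lambda>_. \<delta>) @ entries n (\<lambda>_. 1) @ entries n (\<lambda>_. 0)"
    unfolding z o enc_vec_def list_of_vec_append map_append concat_append enc_rat_vec by simp
  then have b: "enc_vec enc_rat (vec 1 (\<lambda>_. rat_of_int \<delta>) @\<^sub>v ones_vec n @\<^sub>v 0\<^sub>v n) =
      (2 * int n + 1) # [\<delta>, 1] @ entries n (\<lambda>_. 1) @ entries n (\<lambda>_. 0)"
    by (simp add: entries_def)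
  have f: "enc_vec enc_rat (0\<^sub>v n @\<^sub>v ones_vec n @\<^sub>v 0\<^sub>v n :: rat vec) =
      (3 * int n) # entries n (\<lambda>_. 0) @ entries n (\<lambda>_. 1) @ entries n (\<lambda>_. 0)"
    unfolding z o enc_vec_def list_of_vec_append map_append concat_append enc_rat_vec by simp
  have carr: "- 1\<^sub>m n \<in> carrier_mat n n" "1\<^sub>m n \<in> carrier_mat n n" "0\<^sub>m n n \<in> carrier_mat n n" by auto
  have row: "mat_of_rows n [v] \<in> carrier_mat 1 n" for v :: "rat vec"
    by (simp add: mat_of_rows_def)
  \<comment> \<open>All four matrices are stacks of three blocks. The first block has
    \<open>k = 1\<close> row in the leader's matrices and \<open>k = n\<close> rows in the
    follower's.\<close>
  have three: "enc_mat enc_rat (A @\<^sub>r B @\<^sub>r C) =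
      int (k + (n + n)) # int n # mat_entries A @ mat_entries B @ mat_entries C"
    if "A \<in> carrier_mat k n" "B \<in> carrier_mat n n" "C \<in> carrier_mat n n" for A B C k
    using that
    by (simp add: enc_mat_eq[OF carrier_append_rows[OF that(1) carrier_append_rows[OF that(2,3)]]]
        mat_entries_append_rows[OF that(1) carrier_append_rows[OF that(2,3)]]
        mat_entries_append_rows[OF that(2,3)])
  have A: "enc_mat enc_rat (mat_of_rows n [?w] @\<^sub>r 1\<^sub>m n @\<^sub>r - 1\<^sub>m n) =
      (2 * int n + 1) # int n # entries n (\<lambda>i. a $ i) @ diagonal_entries n 1 0 @ diagonal_entries n (- 1) 0"
    unfolding three[OF row carr(2,1)] mat_entries_special by (simp add: w mat_entries_row)
  \<comment> \<open>The zero matrix is cut in the same way as \<open>lbp_A\<close>, so the rule for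
    three blocks covers it as well.\<close>
  have "0\<^sub>m (1 + (n + n)) n = mat_of_rows n [0\<^sub>v n] @\<^sub>r 0\<^sub>m n n @\<^sub>r (0\<^sub>m n n :: rat mat)"
    by (intro eq_matI) (auto simp: append_rows_def mat_of_rows_def)
  then have B: "enc_mat enc_rat (0\<^sub>m (1 + (n + n)) n) =
      (2 * int n + 1) # int n # entries n (\<lambda>_. 0) @ diagonal_entries n 0 0 @ diagonal_entries n 0 0"
    unfolding z by (simp only: three[OF row carr(3,3)] mat_entries_special mat_entries_row) simp
  have C: "enc_mat enc_rat (- 1\<^sub>m n @\<^sub>r 1\<^sub>m n @\<^sub>r 0\<^sub>m n n) =
      (3 * int n) # int n # diagonal_entries n (- 1) 0 @ diagonal_entries n 1 0 @ diagonal_entries n 0 0"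
    unfolding three[OF carr] mat_entries_special by simp
  have D: "enc_mat enc_rat (1\<^sub>m n @\<^sub>r 1\<^sub>m n @\<^sub>r - 1\<^sub>m n) =
      (3 * int n) # int n # diagonal_entries n 1 0 @ diagonal_entries n 1 0 @ diagonal_entries n (- 1) 0"
    unfolding three[OF carr(2,2,1)] mat_entries_special by simp
  show ?thesis
    unfolding enc_lbp_def bl_lbp_def Let_def lbp.simps n_def[symmetric] A B C D b c d e f by simp
qed

section \<open>Running times of programs\<close>

lemma int_size_le_Suc:
  assumes "\<bar>k\<bar> < 2 ^ w"
  shows "int_size k \<le> Suc w"
proof -
  have "bitlen \<bar>k\<bar> \<le> int w" using assms by (simp add: bitlen_le_iff_power)
  then show ?thesis by (simp add: int_size_def)
qed

text \<open>Covers the register addresses and the constants of the programs; hence the recurring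
  assumption \<open>5 \<le> B\<close>.\<close>

lemma int_size_small:
  assumes "\<bar>k\<bar> < 16"
  shows "int_size k \<le> 5"
  using int_size_le_Suc[of k 4] assms by simp

text \<open>This crude bound suffices for the counts \<open>n\<close>, \<open>2 * n + 1\<close> and
  \<open>3 * n\<close>, since \<open>n\<close> itself is bounded by the size of the
  instance.\<close>

lemma int_size_le_Suc_abs: "int_size k \<le> Suc (nat \<bar>k\<bar>)"
proof (rule int_size_le_Suc)
  have "nat \<bar>k\<bar> < 2 ^ nat \<bar>k\<bar>" by (rule less_exp)
  then have "int (nat \<bar>k\<bar>) < int (2 ^ nat \<bar>k\<bar>)" by (simp only: of_nat_less_iff)
  then show "\<bar>k\<bar> < 2 ^ nat \<bar>k\<bar>" by simp
qed

lemma abs_less_int_size: "\<bar>k\<bar> < 2 ^ (int_size k - 1)"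
proof (cases "k = 0")
  case False
  then show ?thesis using bitlen_bounds[of "\<bar>k\<bar>"] by (simp add: int_size_def)
qed (simp add: int_size_def)

lemma int_size_mono:
  assumes "\<bar>k\<bar> \<le> \<bar>l\<bar>"
  shows "int_size k \<le> int_size l"
  using int_size_le_Suc[of k "int_size l - 1"] abs_less_int_size[of l] assms
  by (auto simp: int_size_def)

text \<open>Squaring doubles the number of bits. The second form is the coefficient
  \<open>- M\<close> for \<open>M = k^2 + 1\<close>; the added unit fits because
  \<open>int_size\<close> counts one more than the number of bits.\<close>

lemma int_size_square:
  shows "int_size (k\<^sup>2) \<le> 2 * int_size k" "int_size (- k\<^sup>2 - 1) \<le> 2 * int_size k"
proof -
  define w where "w = int_size k - 1"
  have w: "int_size k = Suc w" by (simp add: w_def int_size_def)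
  have "k\<^sup>2 = \<bar>k\<bar> * \<bar>k\<bar>" by (simp add: power2_eq_square)
  also have "\<dots> < 2 ^ w * 2 ^ w"
    using abs_less_int_size[of k] unfolding w_def by (intro mult_strict_mono) auto
  also have "\<dots> = (2 :: int) ^ (2 * w)" by (simp add: power_add[symmetric] mult_2)
  finally have "k\<^sup>2 + 1 \<le> 2 ^ (2 * w)" by simp
  moreover have "(2 :: int) ^ (2 * w) < 2 ^ (2 * w + 1)" by simp
  ultimately have "\<bar>k\<^sup>2\<bar> < 2 ^ (2 * w + 1)" "\<bar>- k\<^sup>2 - 1\<bar> < 2 ^ (2 * w + 1)"
    using zero_le_power2[of k] by linarith+
  from this[THEN int_size_le_Suc] w
  show "int_size (k\<^sup>2) \<le> 2 * int_size k" "int_size (- k\<^sup>2 - 1) \<le> 2 * int_size k" by simp_all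
qed

section \<open>A Hoare logic with running times\<close>

text \<open>Total correctness with a cost bound: since \<open>exec\<close> is a relation between
  states, the existence of a halting run is part of the claim.\<close>

definition runs :: "(state \<Rightarrow> bool) \<Rightarrow> com \<Rightarrow> (state \<Rightarrow> bool) \<Rightarrow> nat \<Rightarrow> bool" where
  "runs P c Q T \<longleftrightarrow> (\<forall>s. P s \<longrightarrow> (\<exists>t s'. exec c s t s' \<and> t \<le> T \<and> Q s'))"

lemma runs_weaken:
  assumes "runs P c Q T" "\<And>s. P' s \<Longrightarrow> P s" "\<And>s. Q s \<Longrightarrow> Q' s" "T \<le> T'"
  shows "runs P' c Q' T'"
  using assms unfolding runs_def by (meson le_trans)

lemma runs_Skip: "(\<And>s. P s \<Longrightarrow> Q s) \<Longrightarrow> 1 \<le> T \<Longrightarrow> runs P Skip Q T"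
  unfolding runs_def using exec.Skip by blast

lemma runs_Arith:
  assumes "\<And>s. P s \<Longrightarrow> loc_cost s l + operand_cost s u + operand_cost s v \<le> T"
    and "\<And>s. P s \<Longrightarrow> Q (store l (binop_val f (operand_val s u) (operand_val s v)) s)"
  shows "runs P (Arith l f u v) Q T"
  unfolding runs_def using assms exec.Arith by blast

lemma runs_Read:
  assumes "\<And>s. P s \<Longrightarrow> loc_cost s l + int_size (next_input s) \<le> T"
    and "\<And>s. P s \<Longrightarrow> Q ((store l (next_input s) s)\<lparr>inp := tl (inp s)\<rparr>)"
  shows "runs P (Read l) Q T"
  unfolding runs_def using assms exec.Read by blast

lemma runs_Write:
  assumes "\<And>s. P s \<Longrightarrow> operand_cost s u \<le> T"
    and "\<And>s. P s \<Longrightarrow> Q (s\<lparr>out := out s @ [operand_val s u]\<rparr>)"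
  shows "runs P (Write u) Q T"
  unfolding runs_def using assms exec.Write by blast

lemma runs_Seq:
  assumes "runs P c1 R T1" "runs R c2 Q T2"
  shows "runs P (Seq c1 c2) Q (T1 + T2)"
  unfolding runs_def
proof (intro allI impI)
  fix s assume "P s"
  with assms obtain t1 s' t2 s'' where
    "exec c1 s t1 s'" "t1 \<le> T1" "exec c2 s' t2 s''" "t2 \<le> T2" "Q s''"
    unfolding runs_def by meson
  then show "\<exists>t s'. exec (Seq c1 c2) s t s' \<and> t \<le> T1 + T2 \<and> Q s'"
    using exec.Seq add_mono by blast
qed

lemma runs_If:
  assumes "runs (\<lambda>s. P s \<and> test_val s b) c1 Q T" "runs (\<lambda>s. P s \<and> \<not> test_val s b) c2 Q T"
    and "\<And>s. P s \<Longrightarrow> test_cost s b \<le> T'"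
  shows "runs P (If b c1 c2) Q (T' + T)"
  unfolding runs_def
proof (intro allI impI)
  fix s assume P: "P s"
  show "\<exists>t s'. exec (If b c1 c2) s t s' \<and> t \<le> T' + T \<and> Q s'"
  proof (cases "test_val s b")
    case True
    with P assms(1) obtain t s' where "exec c1 s t s'" "t \<le> T" "Q s'"
      unfolding runs_def by meson
    then show ?thesis using exec.IfTrue[OF True] assms(3)[OF P] add_mono by blast
  next
    case False
    with P assms(2) obtain t s' where "exec c2 s t s'" "t \<le> T" "Q s'"
      unfolding runs_def by meson
    then show ?thesis using exec.IfFalse[OF False] assms(3)[OF P] add_mono by blast
  qed
qed

text \<open>Register \<open>-1\<close> holds the number of iterations; the body finds the index in register \<open>i\<close>.\<close>

definition for_loop :: "int \<Rightarrow> com \<Rightarrow> com" where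
  "for_loop i c =
     Seq (Arith (Dir i) Add (Const 0) (Const 0))
       (While (Less (Loc (Dir i)) (Loc (Dir (- 1))))
         (Seq c (Arith (Dir i) Add (Loc (Dir i)) (Const 1))))"

text \<open>Induction on the number of iterations left. The body must preserve the counter, and
  \<open>stable\<close> lets the increment pass through the invariant. Each iteration pays
  \<open>4 * B\<close> for the test and \<open>4 * B\<close> for the increment; the last
  \<open>8 * B\<close> covers the initialization and the failing test.\<close>

lemma runs_for_loop:
  assumes body: "\<And>k. k < n \<Longrightarrow>
      runs (\<lambda>s. I k s \<and> mem s i = int k) c (\<lambda>s. I (Suc k) s \<and> mem s i = int k) T"
    and stable: "\<And>k s v. I k s \<Longrightarrow> I k (s\<lparr>mem := (mem s)(i := v)\<rparr>)"
    and limit: "\<And>k s. I k s \<Longrightarrow> mem s (- 1) = int n"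
    and B: "5 \<le> B" "int_size i \<le> B" "int_size (int n) \<le> B"
  shows "runs (I 0) (for_loop i c) (I n) (n * (T + 8 * B) + 8 * B)"
proof -
  let ?b = "Less (Loc (Dir i)) (Loc (Dir (- 1)))"
  let ?inc = "Arith (Dir i) Add (Loc (Dir i)) (Const 1)"
  have small: "int_size (- 1) \<le> B" "int_size 0 \<le> B" "int_size 1 \<le> B"
    using B(1) int_size_small[of "- 1"] int_size_small[of 0] int_size_small[of 1] by auto
  have size: "int_size (int k) \<le> B" if "k \<le> n" for k
    using int_size_mono[of "int k" "int n"] that B(3) by simp
  have test: "test_cost s ?b \<le> 4 * B" if "I k s" "mem s i = int k" "k \<le> n" for k s
    using that limit[OF that(1)] size[OF that(3)] B small by simp
  have loop: "runs (\<lambda>s. I k s \<and> mem s i = int k) (While ?b (Seq c ?inc)) (I n)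
      ((n - k) * (T + 8 * B) + 4 * B)" if "k \<le> n" for k
    using that
  proof (induction k rule: inc_induct)
    case base
    show ?case
      unfolding runs_def
    proof (intro allI impI)
      fix s assume s: "I n s \<and> mem s i = int n"
      then have "\<not> test_val s ?b" using limit by auto
      from exec.WhileFalse[OF this] s test[of n s]
      show "\<exists>t s'. exec (While ?b (Seq c ?inc)) s t s' \<and>
          t \<le> (n - n) * (T + 8 * B) + 4 * B \<and> I n s'" by auto
    qed
  next
    case (step k)
    have "runs (\<lambda>s. I (Suc k) s \<and> mem s i = int k) ?inc
        (\<lambda>s. I (Suc k) s \<and> mem s i = int (Suc k)) (4 * B)"
      by (rule runs_Arith) (use stable B small size[of k] step in \<open>auto simp: store_def\<close>)
    then have it: "runs (\<lambda>s. I k s \<and> mem s i = int k) (Seq c ?inc)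
        (\<lambda>s. I (Suc k) s \<and> mem s i = int (Suc k)) (T + 4 * B)"
      using body step.hyps runs_Seq by blast
    show ?case
      unfolding runs_def
    proof (intro allI impI)
      fix s assume s: "I k s \<and> mem s i = int k"
      then obtain t1 s' where s': "exec (Seq c ?inc) s t1 s'" "t1 \<le> T + 4 * B"
        "I (Suc k) s'" "mem s' i = int (Suc k)"
        using it unfolding runs_def by meson
      then obtain t2 s'' where s'': "exec (While ?b (Seq c ?inc)) s' t2 s''"
        "t2 \<le> (n - Suc k) * (T + 8 * B) + 4 * B" "I n s''"
        using step.IH unfolding runs_def by meson
      have b: "test_val s ?b" using s limit step.hyps by auto
      have "test_cost s ?b + t1 + t2 \<le> 4 * B + (T + 4 * B) + ((n - Suc k) * (T + 8 * B) + 4 * B)"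
        using test[of k s] s step.hyps s'(2) s''(2) by (intro add_mono) auto
      also have "\<dots> = Suc (n - Suc k) * (T + 8 * B) + 4 * B" by simp
      also have "Suc (n - Suc k) = n - k" using step.hyps by simp
      finally show "\<exists>t s'. exec (While ?b (Seq c ?inc)) s t s' \<and>
          t \<le> (n - k) * (T + 8 * B) + 4 * B \<and> I n s'"
        using exec.WhileTrue[OF b s'(1) s''(1)] s''(3) by blast
    qed
  qed
  have "runs (I 0) (Arith (Dir i) Add (Const 0) (Const 0)) (\<lambda>s. I 0 s \<and> mem s i = int 0) (4 * B)"
    by (rule runs_Arith) (use stable B small in \<open>auto simp: store_def\<close>)
  from runs_Seq[OF this loop[of 0]] show ?thesis
    unfolding for_loop_def by (rule runs_weaken) auto
qed

section \<open>Programs that append to the output\<close>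

text \<open>The invariant speaks of the memory only, and the earlier output \<open>vs\<close> is
  arbitrary; both make such programs easy to chain.\<close>

definition emits :: "((int \<Rightarrow> int) \<Rightarrow> bool) \<Rightarrow> com \<Rightarrow> int list \<Rightarrow> nat \<Rightarrow> bool" where
  "emits P c us T \<longleftrightarrow>
     (\<forall>vs. runs (\<lambda>s. P (mem s) \<and> out s = vs) c (\<lambda>s. P (mem s) \<and> out s = vs @ us) T)"

lemma emits_weaken:
  assumes "emits P c us T" "T \<le> T'"
  shows "emits P c us T'"
  unfolding emits_def
proof
  fix vs
  show "runs (\<lambda>s. P (mem s) \<and> out s = vs) c (\<lambda>s. P (mem s) \<and> out s = vs @ us) T'"
    by (rule runs_weaken[OF assms(1)[unfolded emits_def, rule_format]]) (use assms(2) in auto)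
qed

lemma emits_Write:
  assumes "\<And>s. P (mem s) \<Longrightarrow> operand_val s u = k \<and> operand_cost s u \<le> T"
  shows "emits P (Write u) [k] T"
  unfolding emits_def by (intro allI runs_Write) (use assms in auto)

lemma emits_Seq:
  assumes "emits P c1 us1 T1" "emits P c2 us2 T2"
  shows "emits P (Seq c1 c2) (us1 @ us2) (T1 + T2)"
  unfolding emits_def
proof
  fix vs
  show "runs (\<lambda>s. P (mem s) \<and> out s = vs) (Seq c1 c2)
      (\<lambda>s. P (mem s) \<and> out s = vs @ us1 @ us2) (T1 + T2)"
    using assms(1)[unfolded emits_def, rule_format, of vs]
      assms(2)[unfolded emits_def, rule_format, of "vs @ us1"]
    by (simp add: runs_Seq)
qed

text \<open>A common bound \<open>T\<close> reduces the total cost to counting the pieces; the final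
  \<open>1\<close> pays for the closing \<open>Skip\<close>.\<close>

lemma emits_foldr_Seq:
  assumes "list_all2 (\<lambda>c us. emits P c us T) cs uss"
  shows "emits P (foldr Seq cs Skip) (concat uss) (length cs * T + 1)"
  using assms
proof (induction rule: list_all2_induct)
  case Nil
  show ?case by (auto simp: emits_def intro!: runs_Skip)
next
  case (Cons c cs us uss)
  from emits_Seq[OF Cons.hyps(1) Cons.IH] show ?case by (simp add: add.assoc)
qed

text \<open>The invariant fixes the outcome \<open>d\<close> of the test, so only the branch taken
  has to emit the right list.\<close>

lemma emits_If:
  assumes "\<And>s. P (mem s) \<Longrightarrow> test_val s b = d \<and> test_cost s b \<le> T'"
    and "emits P (if d then c1 else c2) us T"
  shows "emits P (If b c1 c2) us (T' + T)"
  unfolding emits_def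
proof (intro allI runs_If)
  fix vs
  have *: "runs (\<lambda>s. P (mem s) \<and> out s = vs) (if d then c1 else c2)
      (\<lambda>s. P (mem s) \<and> out s = vs @ us) T"
    using assms(2) by (simp add: emits_def)
  show "runs (\<lambda>s. (P (mem s) \<and> out s = vs) \<and> test_val s b) c1
      (\<lambda>s. P (mem s) \<and> out s = vs @ us) T"
    using * assms(1) by (cases d) (auto simp: runs_def)
  show "runs (\<lambda>s. (P (mem s) \<and> out s = vs) \<and> \<not> test_val s b) c2
      (\<lambda>s. P (mem s) \<and> out s = vs @ us) T"
    using * assms(1) by (cases d) (auto simp: runs_def)
qed (use assms(1) in auto)

text \<open>During the body the counter value belongs to the invariant, so the emitted piece may
  depend on \<open>k\<close>.\<close>

lemma emits_for_loop:
  assumes body: "\<And>k. k < n \<Longrightarrow> emits (\<lambda>m. P m \<and> m i = int k) c (us k) T"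
    and stable: "\<And>m v. P m \<Longrightarrow> P (m(i := v))"
    and limit: "\<And>m. P m \<Longrightarrow> m (- 1) = int n"
    and B: "5 \<le> B" "int_size i \<le> B" "int_size (int n) \<le> B"
  shows "emits P (for_loop i c) (concat (map us [0..<n])) (n * (T + 8 * B) + 8 * B)"
  unfolding emits_def
proof
  fix vs
  define I where "I = (\<lambda>k (s :: state). P (mem s) \<and> out s = vs @ concat (map us [0..<k]))"
  have "runs (I 0) (for_loop i c) (I n) (n * (T + 8 * B) + 8 * B)"
  proof (rule runs_for_loop)
    show "runs (\<lambda>s. I k s \<and> mem s i = int k) c (\<lambda>s. I (Suc k) s \<and> mem s i = int k) T"
      if "k < n" for k
      using body[OF that, unfolded emits_def, rule_format, of "vs @ concat (map us [0..<k])"]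
      by (rule runs_weaken) (auto simp: I_def)
    show "mem s (- 1) = int n" if "I k s" for k s
      using that limit unfolding I_def by blast
  qed (use stable B in \<open>auto simp: I_def\<close>)
  then show "runs (\<lambda>s. P (mem s) \<and> out s = vs) (for_loop i c)
      (\<lambda>s. P (mem s) \<and> out s = vs @ concat (map us [0..<n])) (n * (T + 8 * B) + 8 * B)"
    by (simp add: I_def)
qed

section \<open>Writing rows and square blocks\<close>

definition write_entry :: "operand \<Rightarrow> com" where
  "write_entry u = Seq (Write u) (Write (Const 1))"

text \<open>The operand may refer to the counter: \<open>Ind (- 4)\<close> walks through the stored
  vector, while a constant or a fixed register yields a constant row.\<close>

definition write_entries :: "operand \<Rightarrow> com" where
  "write_entries u = for_loop (- 4) (write_entry u)"

text \<open>The counter in \<open>-4\<close> is the row and the one in \<open>-5\<close> the column;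
  both loops run up to the content of register \<open>-1\<close>.\<close>

definition write_diagonal :: "int \<Rightarrow> int \<Rightarrow> com" where
  "write_diagonal k l = for_loop (- 4) (for_loop (- 5)
     (If (Equal (Loc (Dir (- 4))) (Loc (Dir (- 5)))) (write_entry (Const k)) (write_entry (Const l))))"

text \<open>The \<open>3 * B\<close> allows for an indirect operand, which is charged for the
  register, for the address it holds and for the value found there.\<close>

lemma emits_write_entry:
  assumes "\<And>s. P (mem s) \<Longrightarrow> operand_val s u = k \<and> operand_cost s u \<le> 3 * B" "5 \<le> B"
  shows "emits P (write_entry u) [k, 1] (4 * B)"
proof -
  have "emits P (Write (Const 1)) [1] B"
    by (rule emits_Write) (use int_size_small[of 1] assms(2) in auto)
  from emits_Seq[OF emits_Write[OF assms(1)] this] show ?thesis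
    unfolding write_entry_def by simp
qed

text \<open>The bound is relaxed to the quadratic one of \<open>emits_write_diagonal\<close>, so
  that all pieces share one \<open>T\<close>.\<close>

lemma emits_write_entries:
  assumes "\<And>k s. k < n \<Longrightarrow> P (mem s) \<Longrightarrow> mem s (- 4) = int k \<Longrightarrow>
      operand_val s u = f k \<and> operand_cost s u \<le> 3 * B"
    and "\<And>m v. P m \<Longrightarrow> P (m(- 4 := v))"
    and "\<And>m. P m \<Longrightarrow> m (- 1) = int n"
    and B: "5 \<le> B" "int_size (int n) \<le> B"
  shows "emits P (write_entries u) (entries n f) (16 * B * (n + 1) ^ 2)"
proof -
  have small: "int_size (- 4) \<le> B"
    using B(1) int_size_small[of "- 4"] by auto
  have "emits P (write_entries u) (entries n f) (n * (4 * B + 8 * B) + 8 * B)"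
    unfolding write_entries_def entries_def
    by (intro emits_for_loop emits_write_entry) (use assms small in blast)+
  moreover have "16 * B * (n + 1)\<^sup>2 =
      n * (4 * B + 8 * B) + 8 * B + (16 * (B * (n * n)) + 20 * (B * n) + 8 * B)"
    by (simp add: power2_eq_square algebra_simps)
  ultimately show ?thesis
    by (elim emits_weaken) linarith
qed

text \<open>In each cell both counters are known, which decides the test. A cell costs
  \<open>4 * B\<close> for the test, \<open>4 * B\<close> for the two numbers and
  \<open>8 * B\<close> for the loop, hence the leading term \<open>16 * B * n^2\<close>.\<close>

lemma emits_write_diagonal:
  assumes stable: "\<And>m v. P m \<Longrightarrow> P (m(- 4 := v))" "\<And>m v. P m \<Longrightarrow> P (m(- 5 := v))"
    and limit: "\<And>m. P m \<Longrightarrow> m (- 1) = int n"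
    and B: "5 \<le> B" "int_size (int n) \<le> B" "int_size k \<le> B" "int_size l \<le> B"
  shows "emits P (write_diagonal k l)
    (diagonal_entries n k l)
    (16 * B * (n + 1) ^ 2)"
proof -
  have small: "int_size (- 4) \<le> B" "int_size (- 5) \<le> B"
    using B(1) int_size_small[of "- 4"] int_size_small[of "- 5"] by auto
  have size: "int_size (int k) \<le> B" if "k < n" for k
    using int_size_mono[of "int k" "int n"] that B(2) by simp
  have "emits P (write_diagonal k l)
      (diagonal_entries n k l)
      (n * ((n * ((4 * B + 4 * B) + 8 * B) + 8 * B) + 8 * B) + 8 * B)"
    unfolding write_diagonal_def diagonal_entries_def entries_def
  proof (intro emits_for_loop)
    fix i j assume ij: "i < n" "j < n"
    show "emits (\<lambda>m. (P m \<and> m (- 4) = int i) \<and> m (- 5) = int j)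
       (If (Equal (Loc (Dir (- 4))) (Loc (Dir (- 5)))) (write_entry (Const k)) (write_entry (Const l)))
       [if i = j then k else l, 1] (4 * B + 4 * B)"
    proof (rule emits_If[where d = "i = j"])
      show "emits (\<lambda>m. (P m \<and> m (- 4) = int i) \<and> m (- 5) = int j)
        (if i = j then write_entry (Const k) else write_entry (Const l))
        [if i = j then k else l, 1] (4 * B)"
        using B by (auto intro!: emits_write_entry)
    qed (use small size[of i] size[of j] ij in auto)
  qed (use stable B small in auto, (use limit in blast)+)
  moreover have "16 * B * (n + 1)\<^sup>2 =
      n * ((n * ((4 * B + 4 * B) + 8 * B) + 8 * B) + 8 * B) + 8 * B + (16 * (B * n) + 8 * B)"
    by (simp add: power2_eq_square algebra_simps)
  ultimately show ?thesis
    by (elim emits_weaken) linarith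
qed

section \<open>The reduction\<close>

text \<open>
  The nonnegative addresses hold the vector, so a loop counter is also a pointer into it. The
  counters of the loops are at \<open>-4\<close> and \<open>-5\<close>.
\<close>

definition registers ::
    "nat \<Rightarrow> int list \<Rightarrow> int \<Rightarrow> int \<Rightarrow> int \<Rightarrow> int \<Rightarrow> (int \<Rightarrow> int) \<Rightarrow> bool" where
  "registers n xs p d q r m \<longleftrightarrow>
     m (- 1) = int n \<and> m (- 2) = p \<and> m (- 3) = d \<and> m (- 6) = q \<and> m (- 7) = r \<and>
     (\<forall>j<length xs. m (int j) = xs ! j)"

lemma registers_update_counter:
  assumes "registers n xs p d q r m" "i = - 4 \<or> i = - 5"
  shows "registers n xs p d q r (m(i := v))"
  using assms by (auto simp: registers_def)

section \<open>Writing the bilevel instance\<close>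

text \<open>Register \<open>-1\<close> holds \<open>n\<close>, \<open>-2\<close> the follower
  coefficient \<open>- M\<close>, \<open>-3\<close> the capacity, and \<open>-6\<close> and
  \<open>-7\<close> the row counts \<open>2 * n + 1\<close> and \<open>3 * n\<close>.\<close>

definition output_program :: com where
  "output_program = foldr Seq
    [Write (Loc (Dir (- 1))), write_entries (Loc (Ind (- 4))),
     Write (Loc (Dir (- 1))), write_entries (Loc (Dir (- 2))),
     Write (Loc (Dir (- 6))), Write (Loc (Dir (- 1))), write_entries (Loc (Ind (- 4))),
       write_diagonal 1 0, write_diagonal (- 1) 0,
     Write (Loc (Dir (- 6))), Write (Loc (Dir (- 1))), write_entries (Const 0),
       write_diagonal 0 0, write_diagonal 0 0,
     Write (Loc (Dir (- 6))), write_entry (Loc (Dir (- 3))), write_entries (Const 1), write_entries (Const 0),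
     Write (Loc (Dir (- 1))), write_entries (Const 1),
     Write (Loc (Dir (- 7))), Write (Loc (Dir (- 1))),
       write_diagonal (- 1) 0, write_diagonal 1 0, write_diagonal 0 0,
     Write (Loc (Dir (- 7))), Write (Loc (Dir (- 1))),
       write_diagonal 1 0, write_diagonal 1 0, write_diagonal (- 1) 0,
     Write (Loc (Dir (- 7))), write_entries (Const 0), write_entries (Const 1), write_entries (Const 0)]
    Skip"

text \<open>The factor \<open>34\<close> is the number of pieces, each of which stays within the
  bound of a block.\<close>

lemma emits_output_program:
  fixes a :: "int vec" and \<delta> M :: int
  defines "n \<equiv> dim_vec a"
  assumes B: "5 \<le> B" "int_size (int n) \<le> B" "int_size (2 * int n + 1) \<le> B" "int_size (3 * int n) \<le> B"
    "int_size (- M) \<le> B" "int_size \<delta> \<le> B" "\<forall>k\<in>set (list_of_vec a). int_size k \<le> B"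
  shows "emits (registers n (list_of_vec a) (- M) \<delta> (2 * int n + 1) (3 * int n)) output_program
    (enc_lbp (bl_lbp a \<delta> M)) (34 * (16 * B * (n + 1)\<^sup>2) + 1)"
proof -
  let ?P = "registers n (list_of_vec a) (- M) \<delta> (2 * int n + 1) (3 * int n)"
  define K where "K = 16 * B * (n + 1)\<^sup>2"
  \<comment> \<open>Ensures that the bound \<open>K\<close> of the loops also covers the pieces that
    write only one or two numbers.\<close>
  have "B * 1 \<le> B * (n + 1)\<^sup>2" by (intro mult_le_mono2) simp
  then have K: "4 * B \<le> K" unfolding K_def by linarith
  have small: "int_size k \<le> B" if "\<bar>k\<bar> < 16" for k
    using int_size_small[OF that] B(1) by linarith
  have limit: "m (- 1) = int n" if "?P m" for m using that by (simp add: registers_def)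
  have reg: "emits ?P (Write (Loc (Dir i))) [k] K"
    if "\<And>m. ?P m \<Longrightarrow> m i = k" "\<bar>i\<bar> < 16" "int_size k \<le> B" for i k
  proof (rule emits_Write)
    fix s :: state
    assume "?P (mem s)"
    then have "mem s i = k" by (rule that(1))
    then show "operand_val s (Loc (Dir i)) = k \<and> operand_cost s (Loc (Dir i)) \<le> K"
      using that(3) small[OF that(2)] K by simp
  qed
  have regs: "emits ?P (Write (Loc (Dir (- 1)))) [int n] K"
    "emits ?P (Write (Loc (Dir (- 6)))) [2 * int n + 1] K"
    "emits ?P (Write (Loc (Dir (- 7)))) [3 * int n] K"
    by (rule reg; use B in \<open>simp add: registers_def\<close>)+
  have const: "emits ?P (write_entries (Const k)) (entries n (\<lambda>_. k)) K" if "\<bar>k\<bar> < 16" for k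
    unfolding K_def
    by (rule emits_write_entries)
      (use B small[OF that] limit in \<open>auto intro: registers_update_counter\<close>)
  have d: "emits ?P (write_entries (Loc (Dir (- 2)))) (entries n (\<lambda>_. - M)) K"
    unfolding K_def
    by (rule emits_write_entries)
      (use B small[of "- 2"] in \<open>auto intro: registers_update_counter simp: registers_def\<close>)
  have w: "emits ?P (write_entries (Loc (Ind (- 4)))) (entries n (\<lambda>i. a $ i)) K"
    unfolding K_def
  proof (rule emits_write_entries)
    fix k :: nat and s :: state
    assume k: "k < n" and s: "?P (mem s)" "mem s (- 4) = int k"
    have "mem s (int k) = a $ k"
      using k s by (simp add: registers_def n_def)
    moreover have "int_size (a $ k) \<le> B"
      using B(7) k by (auto simp: n_def list_of_vec_map)
    moreover have "int_size (int k) \<le> B"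
      using int_size_mono[of "int k" "int n"] k B(2) by simp
    ultimately show "operand_val s (Loc (Ind (- 4))) = a $ k \<and> operand_cost s (Loc (Ind (- 4))) \<le> 3 * B"
      using s small[of "- 4"] by simp
  qed (use B limit in \<open>auto intro: registers_update_counter\<close>)
  have \<delta>: "emits ?P (write_entry (Loc (Dir (- 3)))) [\<delta>, 1] K"
    by (rule emits_weaken[OF emits_write_entry[where B = B] K])
      (use B small[of "- 3"] in \<open>auto simp: registers_def\<close>)
  have diag: "emits ?P (write_diagonal k l) (diagonal_entries n k l) K" if "\<bar>k\<bar> < 16" "\<bar>l\<bar> < 16" for k l
    unfolding K_def
    by (rule emits_write_diagonal)
      (use B small[OF that(1)] small[OF that(2)] limit in \<open>auto intro: registers_update_counter\<close>)
  show ?thesis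
    unfolding K_def[symmetric] output_program_def enc_lbp_bl_lbp n_def[symmetric]
    by (rule emits_weaken[OF emits_foldr_Seq[where T = K]])
      (simp_all only: list_all2_Cons list_all2_Nil regs const d w \<delta> diag, simp_all)
qed

section \<open>Reading the knapsack instance\<close>

lemma next_input_Cons: "inp s = k # ks \<Longrightarrow> next_input s = k"
  by (simp add: next_input_def)

text \<open>Register \<open>-2\<close> collects the running maximum, starting from the initial
  memory value \<open>0\<close>, and is then turned into \<open>- \<beta>^2 - 1\<close>, which is
  \<open>- M\<close>.\<close>

definition input_program :: com where
  "input_program =
     Seq (Read (Dir (- 1)))
    (Seq (for_loop (- 4)
       (Seq (Read (Ind (- 4)))
         (If (Less (Loc (Dir (- 2))) (Loc (Ind (- 4))))
           (Arith (Dir (- 2)) Add (Loc (Ind (- 4))) (Const 0)) Skip)))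
    (Seq (Read (Dir (- 3)))
    (Seq (Arith (Dir (- 2)) Mul (Loc (Dir (- 2))) (Loc (Dir (- 2))))
    (Seq (Arith (Dir (- 2)) Sub (Const (- 1)) (Loc (Dir (- 2))))
    (Seq (Arith (Dir (- 6)) Mul (Const 2) (Loc (Dir (- 1))))
    (Seq (Arith (Dir (- 6)) Add (Loc (Dir (- 6))) (Const 1))
         (Arith (Dir (- 7)) Mul (Const 3) (Loc (Dir (- 1))))))))))"

text \<open>Bounds the length of every running maximum by that of an entry or of
  \<open>0\<close>.\<close>

lemma fold_max_mem: "fold max xs (0 :: int) \<in> insert 0 (set xs)"
  using Max_in[of "set (0 # xs)"] unfolding Max.set_eq_fold by simp

text \<open>Loop invariant: the first \<open>k\<close> entries are stored at the addresses below
  \<open>k\<close>, their maximum is in register \<open>-2\<close>, and the rest is still on the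
  tape.\<close>

lemma runs_input_program:
  fixes xs :: "int list"
  defines "n \<equiv> length xs" and "\<beta> \<equiv> fold max xs 0"
  assumes B: "5 \<le> B" "int_size (int n) \<le> B" "int_size (2 * int n + 1) \<le> B" "int_size (\<beta>\<^sup>2) \<le> B"
    "int_size \<delta> \<le> B" "\<forall>k\<in>set xs. int_size k \<le> B"
  shows "runs (\<lambda>s. s = \<lparr>mem = (\<lambda>_. 0), inp = int n # xs @ [\<delta>], out = []\<rparr>) input_program
    (\<lambda>s. registers n xs (- \<beta>\<^sup>2 - 1) \<delta> (2 * int n + 1) (3 * int n) (mem s) \<and> out s = [])
    (60 * B * (n + 1))"
proof -
  have small: "int_size k \<le> B" if "\<bar>k\<bar> < 16" for k
    using int_size_small[OF that] B(1) by linarith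
  note smalls = small[of "- 1"] small[of "- 2"] small[of "- 3"] small[of "- 4"] small[of "- 6"]
    small[of "- 7"] small[of 0] small[of 1] small[of 2] small[of 3]
  have size: "int_size (int k) \<le> B" if "k \<le> n" for k
    using int_size_mono[of "int k" "int n"] that B(2) by simp
  have max: "int_size (fold max (take k xs) 0) \<le> B" for k
    using fold_max_mem[of "take k xs"] B(6) small[of 0] by (auto dest: in_set_takeD)
  define I where "I = (\<lambda>k (s :: state). registers n (take k xs) (fold max (take k xs) 0) 0 0 0 (mem s) \<and>
    inp s = drop k xs @ [\<delta>] \<and> out s = [])"
  \<comment> \<open>The arithmetic after the last read concerns only the registers, so
    \<open>J\<close> no longer tracks the input.\<close>
  define J where "J = (\<lambda>p d q r (s :: state). registers n xs p d q r (mem s) \<and> out s = [])"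
  have loop: "runs (I 0) (for_loop (- 4)
       (Seq (Read (Ind (- 4)))
         (If (Less (Loc (Dir (- 2))) (Loc (Ind (- 4))))
           (Arith (Dir (- 2)) Add (Loc (Ind (- 4))) (Const 0)) Skip))) (I n)
       (n * ((3 * B + (5 * B + 5 * B)) + 8 * B) + 8 * B)"
  proof (rule runs_for_loop)
    fix k assume k: "k < n"
    \<comment> \<open>The state once the entry with index \<open>k\<close> is stored;
      \<open>p\<close> is the maximum in register \<open>-2\<close>, before or after its
      update.\<close>
    define R where "R = (\<lambda>p (s :: state). registers n (take (Suc k) xs) p 0 0 0 (mem s) \<and>
      inp s = drop (Suc k) xs @ [\<delta>] \<and> out s = [] \<and> mem s (- 4) = int k)"
    have xk: "int_size (xs ! k) \<le> B" using B(6) k by (simp add: n_def)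
    have head: "next_input s = xs ! k" "tl (inp s) = drop (Suc k) xs @ [\<delta>]" if "I k s" for s
    proof -
      have "inp s = xs ! k # drop (Suc k) xs @ [\<delta>]"
        using that k Cons_nth_drop_Suc[of k xs] by (simp add: I_def n_def)
      then show "next_input s = xs ! k" "tl (inp s) = drop (Suc k) xs @ [\<delta>]"
        by (simp_all add: next_input_Cons)
    qed
    have read: "runs (\<lambda>s. I k s \<and> mem s (- 4) = int k) (Read (Ind (- 4)))
        (R (fold max (take k xs) 0)) (3 * B)"
    proof (rule runs_Read)
      fix s assume s: "I k s \<and> mem s (- 4) = int k"
      then show "loc_cost s (Ind (- 4)) + int_size (next_input s) \<le> 3 * B"
        using head xk size[of k] k smalls by simp
      show "R (fold max (take k xs) 0) ((store (Ind (- 4)) (next_input s) s)\<lparr>inp := tl (inp s)\<rparr>)"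
        using s head k
        by (auto simp: R_def I_def registers_def store_def n_def less_Suc_eq nth_append
            take_Suc_conv_app_nth)
    qed
    have Rk: "mem s (int k) = xs ! k" if "R p s" for p s
      using that k by (auto simp: R_def registers_def n_def)
    have step: "fold max (take (Suc k) xs) 0 = max (xs ! k) (fold max (take k xs) 0)"
      using k by (simp add: take_Suc_conv_app_nth n_def)
    have upd: "runs (R (fold max (take k xs) 0)) (If (Less (Loc (Dir (- 2))) (Loc (Ind (- 4))))
        (Arith (Dir (- 2)) Add (Loc (Ind (- 4))) (Const 0)) Skip)
        (R (fold max (take (Suc k) xs) 0)) (5 * B + 5 * B)"
    proof (rule runs_If)
      show "runs (\<lambda>s. R (fold max (take k xs) 0) s \<and> test_val s (Less (Loc (Dir (- 2))) (Loc (Ind (- 4)))))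
          (Arith (Dir (- 2)) Add (Loc (Ind (- 4))) (Const 0)) (R (fold max (take (Suc k) xs) 0)) (5 * B)"
      proof (rule runs_Arith)
        fix s assume s: "R (fold max (take k xs) 0) s \<and> test_val s (Less (Loc (Dir (- 2))) (Loc (Ind (- 4))))"
        then have s4: "mem s (- 4) = int k" "mem s (int k) = xs ! k" using Rk by (auto simp: R_def)
        then show "loc_cost s (Dir (- 2)) + operand_cost s (Loc (Ind (- 4))) + operand_cost s (Const 0) \<le> 5 * B"
          using xk size[of k] k smalls by simp
        have "fold max (take (Suc k) xs) 0 = xs ! k"
          using s s4 step by (auto simp: R_def registers_def)
        then show "R (fold max (take (Suc k) xs) 0) (store (Dir (- 2)) (binop_val Add
            (operand_val s (Loc (Ind (- 4)))) (operand_val s (Const 0))) s)"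
          using s s4 by (auto simp: R_def registers_def store_def)
      qed
      show "runs (\<lambda>s. R (fold max (take k xs) 0) s \<and> \<not> test_val s (Less (Loc (Dir (- 2))) (Loc (Ind (- 4)))))
          Skip (R (fold max (take (Suc k) xs) 0)) (5 * B)"
      proof (rule runs_Skip)
        fix s assume s: "R (fold max (take k xs) 0) s \<and> \<not> test_val s (Less (Loc (Dir (- 2))) (Loc (Ind (- 4))))"
        then have "mem s (- 4) = int k" "mem s (int k) = xs ! k" using Rk by (auto simp: R_def)
        with s have "fold max (take (Suc k) xs) 0 = fold max (take k xs) 0"
          using step by (auto simp: R_def registers_def)
        with s show "R (fold max (take (Suc k) xs) 0) s" by simp
      qed (use B(1) in simp)
      fix s assume "R (fold max (take k xs) 0) s"
      then show "test_cost s (Less (Loc (Dir (- 2))) (Loc (Ind (- 4)))) \<le> 5 * B"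
        using Rk[of _ s] xk max[of k] size[of k] k smalls by (auto simp: R_def registers_def)
    qed
    show "runs (\<lambda>s. I k s \<and> mem s (- 4) = int k) (Seq (Read (Ind (- 4)))
         (If (Less (Loc (Dir (- 2))) (Loc (Ind (- 4))))
           (Arith (Dir (- 2)) Add (Loc (Ind (- 4))) (Const 0)) Skip))
         (\<lambda>s. I (Suc k) s \<and> mem s (- 4) = int k) (3 * B + (5 * B + 5 * B))"
      using runs_Seq[OF read upd] by (rule runs_weaken) (auto simp: R_def I_def)
  qed (use B smalls in \<open>auto simp: I_def registers_def\<close>)
  have 1: "runs (\<lambda>s. s = \<lparr>mem = (\<lambda>_. 0), inp = int n # xs @ [\<delta>], out = []\<rparr>) (Read (Dir (- 1))) (I 0) (2 * B)"
    by (rule runs_Read) (use B smalls in \<open>auto simp: I_def registers_def store_def next_input_def\<close>)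
  have 2: "runs (I n) (Read (Dir (- 3))) (J \<beta> \<delta> 0 0) (2 * B)"
    by (rule runs_Read)
      (use B smalls in \<open>auto simp: I_def J_def registers_def store_def next_input_def n_def \<beta>_def\<close>)
  have \<beta>: "int_size \<beta> \<le> B" using max[of n] by (simp add: n_def \<beta>_def)
  have 3: "runs (J \<beta> \<delta> 0 0) (Arith (Dir (- 2)) Mul (Loc (Dir (- 2))) (Loc (Dir (- 2)))) (J (\<beta>\<^sup>2) \<delta> 0 0) (5 * B)"
    by (rule runs_Arith)
      (use B smalls \<beta> in \<open>auto simp: J_def registers_def store_def power2_eq_square\<close>)
  have 4: "runs (J (\<beta>\<^sup>2) \<delta> 0 0) (Arith (Dir (- 2)) Sub (Const (- 1)) (Loc (Dir (- 2))))
      (J (- \<beta>\<^sup>2 - 1) \<delta> 0 0) (5 * B)"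
    by (rule runs_Arith) (use B smalls in \<open>auto simp: J_def registers_def store_def\<close>)
  have 5: "runs (J (- \<beta>\<^sup>2 - 1) \<delta> 0 0) (Arith (Dir (- 6)) Mul (Const 2) (Loc (Dir (- 1))))
      (J (- \<beta>\<^sup>2 - 1) \<delta> (2 * int n) 0) (5 * B)"
    by (rule runs_Arith) (use B smalls in \<open>auto simp: J_def registers_def store_def\<close>)
  \<comment> \<open>The intermediate value is charged when the next instruction reads it.\<close>
  have "int_size (2 * int n) \<le> B" using int_size_mono[of "2 * int n" "2 * int n + 1"] B(3) by simp
  then have 6: "runs (J (- \<beta>\<^sup>2 - 1) \<delta> (2 * int n) 0) (Arith (Dir (- 6)) Add (Loc (Dir (- 6))) (Const 1))
      (J (- \<beta>\<^sup>2 - 1) \<delta> (2 * int n + 1) 0) (5 * B)"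
    by (intro runs_Arith) (use B smalls in \<open>auto simp: J_def registers_def store_def\<close>)
  have 7: "runs (J (- \<beta>\<^sup>2 - 1) \<delta> (2 * int n + 1) 0) (Arith (Dir (- 7)) Mul (Const 3) (Loc (Dir (- 1))))
      (J (- \<beta>\<^sup>2 - 1) \<delta> (2 * int n + 1) (3 * int n)) (5 * B)"
    by (rule runs_Arith) (use B smalls in \<open>auto simp: J_def registers_def store_def\<close>)
  show ?thesis
    using runs_Seq[OF 1 runs_Seq[OF loop runs_Seq[OF 2 runs_Seq[OF 3 runs_Seq[OF 4
            runs_Seq[OF 5 runs_Seq[OF 6 7]]]]]]]
    unfolding input_program_def J_def
    by (rule runs_weaken) (simp_all add: algebra_simps)
qed

section \<open>Translating solutions back\<close>

text \<open>The first loop and the read after it skip the entries of \<open>a\<close> and the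
  capacity. Then the dimension of \<open>x\<close> is read and written, and the last loop writes
  each numerator and discards its denominator.\<close>

definition copy_program :: com where
  "copy_program =
     Seq (Read (Dir (- 1)))
    (Seq (for_loop (- 4) (Read (Dir (- 2))))
    (Seq (Read (Dir (- 2)))
    (Seq (Read (Dir (- 1)))
    (Seq (Write (Loc (Dir (- 1))))
         (for_loop (- 4) (Seq (Read (Dir (- 2))) (Seq (Write (Loc (Dir (- 2)))) (Read (Dir (- 3))))))))))"

text \<open>Here \<open>zs\<close> are the numerators of the leader's part of the solution;
  \<open>us\<close> stands for the encoding of the follower's part, which stays on the tape.\<close>

lemma runs_copy_program:
  fixes xs zs us :: "int list"
  defines "n \<equiv> length xs"
  assumes zs: "length zs = n"
    and B: "5 \<le> B" "int_size (int n) \<le> B" "int_size \<delta> \<le> B"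
      "\<forall>k\<in>set xs. int_size k \<le> B" "\<forall>k\<in>set zs. int_size k \<le> B"
  shows "runs (\<lambda>s. s = \<lparr>mem = (\<lambda>_. 0),
      inp = int n # xs @ \<delta> # int n # entries n (\<lambda>i. zs ! i) @ us, out = []\<rparr>) copy_program
    (\<lambda>s. out s = int n # zs) (40 * B * (n + 1))"
proof -
  have small: "int_size k \<le> B" if "\<bar>k\<bar> < 16" for k
    using int_size_small[OF that] B(1) by linarith
  note smalls = small[of "- 1"] small[of "- 2"] small[of "- 3"] small[of "- 4"] small[of 1]
  define vs where "vs = \<delta> # int n # entries n (\<lambda>i. zs ! i) @ us"
  \<comment> \<open>The tape from the numerator-denominator pair with index \<open>k\<close>
    onwards.\<close>
  define ws where "ws = (\<lambda>k. concat (map (\<lambda>i. [zs ! i, 1]) [k..<n]) @ us)"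
  define I where "I = (\<lambda>k (s :: state). mem s (- 1) = int n \<and> inp s = drop k xs @ vs \<and> out s = [])"
  define J where "J = (\<lambda>k (s :: state). mem s (- 1) = int n \<and> inp s = ws k \<and> out s = int n # take k zs)"
  define R where "R = (\<lambda>us vs (s :: state). mem s (- 1) = int n \<and> inp s = us \<and> out s = vs)"
  have 1: "runs (\<lambda>s. s = \<lparr>mem = (\<lambda>_. 0), inp = int n # xs @ vs, out = []\<rparr>) (Read (Dir (- 1))) (I 0) (2 * B)"
    by (rule runs_Read) (use B smalls in \<open>auto simp: I_def store_def next_input_def\<close>)
  have 2: "runs (I 0) (for_loop (- 4) (Read (Dir (- 2)))) (I n) (n * (2 * B + 8 * B) + 8 * B)"
  proof (rule runs_for_loop)
    fix k assume k: "k < n"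
    show "runs (\<lambda>s. I k s \<and> mem s (- 4) = int k) (Read (Dir (- 2)))
        (\<lambda>s. I (Suc k) s \<and> mem s (- 4) = int k) (2 * B)"
    proof (rule runs_Read)
      fix s assume s: "I k s \<and> mem s (- 4) = int k"
      then have i: "inp s = xs ! k # drop (Suc k) xs @ vs"
        using k Cons_nth_drop_Suc[of k xs] by (simp add: I_def n_def)
      then show "loc_cost s (Dir (- 2)) + int_size (next_input s) \<le> 2 * B"
        using B(4) k smalls by (fastforce simp: next_input_Cons n_def mult_2 intro: add_mono)
      show "I (Suc k) ((store (Dir (- 2)) (next_input s) s)\<lparr>inp := tl (inp s)\<rparr>) \<and>
          mem ((store (Dir (- 2)) (next_input s) s)\<lparr>inp := tl (inp s)\<rparr>) (- 4) = int k"
        using s i by (simp add: I_def store_def)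
    qed
  qed (use B smalls in \<open>auto simp: I_def\<close>)
  have 3: "runs (I n) (Read (Dir (- 2))) (R (int n # ws 0) []) (2 * B)"
    by (rule runs_Read)
      (use B smalls in \<open>auto simp: I_def R_def vs_def ws_def entries_def store_def next_input_def n_def\<close>)
  have 4: "runs (R (int n # ws 0) []) (Read (Dir (- 1))) (R (ws 0) []) (2 * B)"
    by (rule runs_Read) (use B smalls in \<open>auto simp: R_def store_def next_input_def\<close>)
  have 5: "runs (R (ws 0) []) (Write (Loc (Dir (- 1)))) (J 0) (2 * B)"
    by (rule runs_Write) (use B smalls in \<open>auto simp: J_def R_def\<close>)
  have 6: "runs (J 0) (for_loop (- 4) (Seq (Read (Dir (- 2))) (Seq (Write (Loc (Dir (- 2)))) (Read (Dir (- 3))))))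
      (J n) (n * ((2 * B + (2 * B + 2 * B)) + 8 * B) + 8 * B)"
  proof (rule runs_for_loop)
    fix k assume k: "k < n"
    have ws: "ws k = zs ! k # 1 # ws (Suc k)" using k by (simp add: ws_def upt_conv_Cons)
    have zk: "int_size (zs ! k) \<le> B" using B(5) k zs by simp
    define S where "S = (\<lambda>ts us vs (s :: state). R us vs s \<and> mem s (- 4) = int k \<and> mem s (- 2) = ts)"
    have a: "runs (\<lambda>s. J k s \<and> mem s (- 4) = int k) (Read (Dir (- 2)))
        (S (zs ! k) (1 # ws (Suc k)) (int n # take k zs)) (2 * B)"
      by (rule runs_Read)
        (use smalls zk ws in \<open>auto simp: J_def R_def S_def store_def next_input_def\<close>)
    have b: "runs (S (zs ! k) (1 # ws (Suc k)) (int n # take k zs)) (Write (Loc (Dir (- 2))))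
        (S (zs ! k) (1 # ws (Suc k)) (int n # take (Suc k) zs)) (2 * B)"
      by (rule runs_Write)
        (use smalls zk zs k in \<open>auto simp: R_def S_def take_Suc_conv_app_nth\<close>)
    have c: "runs (S (zs ! k) (1 # ws (Suc k)) (int n # take (Suc k) zs)) (Read (Dir (- 3)))
        (\<lambda>s. J (Suc k) s \<and> mem s (- 4) = int k) (2 * B)"
      by (rule runs_Read)
        (use B smalls in \<open>auto simp: J_def R_def S_def store_def next_input_def\<close>)
    show "runs (\<lambda>s. J k s \<and> mem s (- 4) = int k)
        (Seq (Read (Dir (- 2))) (Seq (Write (Loc (Dir (- 2)))) (Read (Dir (- 3)))))
        (\<lambda>s. J (Suc k) s \<and> mem s (- 4) = int k) (2 * B + (2 * B + 2 * B))"
      by (rule runs_Seq[OF a runs_Seq[OF b c]])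
  qed (use B smalls in \<open>auto simp: J_def\<close>)
  show ?thesis
    using runs_Seq[OF 1 runs_Seq[OF 2 runs_Seq[OF 3 runs_Seq[OF 4 runs_Seq[OF 5 6]]]]]
    unfolding copy_program_def
    by (rule runs_weaken) (use zs in \<open>simp_all add: J_def vs_def algebra_simps\<close>)
qed

section \<open>Polynomial bounds in the size of the instance\<close>

lemma runs_computes_within:
  assumes "runs (\<lambda>s. s = \<lparr>mem = (\<lambda>_. 0), inp = us, out = []\<rparr>) c (\<lambda>s. out s = vs) T"
  shows "computes_within c us vs T"
  using assms unfolding runs_def computes_within_def by blast

lemma int_size_le_tape_size: "k \<in> set us \<Longrightarrow> int_size k \<le> tape_size us"
  using member_le_sum_list[of "int_size k" "map int_size us"] by (simp add: tape_size_def)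

lemma length_le_tape_size: "length us \<le> tape_size us"
  by (induction us) (auto simp: tape_size_def int_size_def)

lemma enc_kp_eq: "enc_kp (a, \<delta>) = int (dim_vec a) # list_of_vec a @ [\<delta>]"
  by (simp add: enc_kp_def enc_vec_def)

text \<open>Every encoded integer has size at least \<open>1\<close>, so the dimension itself, and
  not only its bit length, is bounded by the size of the instance. This makes a quadratic number of
  matrix entries affordable.\<close>

lemma kp_size_bounds:
  fixes a \<delta>
  defines "N \<equiv> inst_size KNAPSACK (a, \<delta>)"
  shows "dim_vec a \<le> N" "int_size \<delta> \<le> N" "k \<in> set (list_of_vec a) \<Longrightarrow> int_size k \<le> N"
    "int_size (int (dim_vec a)) \<le> N"
proof -
  have N: "N = tape_size (int (dim_vec a) # list_of_vec a @ [\<delta>])"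
    by (simp add: N_def inst_size_def KNAPSACK_def enc_kp_eq)
  show "dim_vec a \<le> N"
    using length_le_tape_size[of "int (dim_vec a) # list_of_vec a @ [\<delta>]"] unfolding N by simp
  show "int_size \<delta> \<le> N" "k \<in> set (list_of_vec a) \<Longrightarrow> int_size k \<le> N"
    "int_size (int (dim_vec a)) \<le> N"
    unfolding N by (rule int_size_le_tape_size; simp)+
qed

text \<open>Starting the running maximum at \<open>0\<close> is harmless, because the largest entry
  is at least \<open>2\<close>.\<close>

lemma max_entry_eq_fold:
  assumes "(a, \<delta>) \<in> kp_instances"
  shows "max_entry a = fold max (list_of_vec a) 0"
proof -
  have s: "set (list_of_vec a) = (\<lambda>i. a $ i) ` {..<dim_vec a}"
    by (auto simp: list_of_vec_map)
  have ne: "set (list_of_vec a) \<noteq> {}"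
    using assms unfolding s by (auto simp: kp_instances_def)
  have "fold max (list_of_vec a) 0 = max 0 (Max (set (list_of_vec a)))"
    using ne Max.set_eq_fold[of 0 "list_of_vec a"] by simp
  also have "Max (set (list_of_vec a)) = max_entry a" unfolding s max_entry_def ..
  also have "max 0 (max_entry a) = max_entry a" using assms by (simp add: kp_instances_def)
  finally show ?thesis by simp
qed

lemma computes_bl_lbp:
  assumes inst: "(a, \<delta>) \<in> kp_instances"
  shows "computes_within (Seq input_program output_program) (enc_kp (a, \<delta>))
    (enc_lbp (bl_lbp a \<delta> ((max_entry a)\<^sup>2 + 1))) (1000 * (3 * inst_size KNAPSACK (a, \<delta>) + 6) ^ 3)"
proof -
  define n where "n = dim_vec a"
  define xs where "xs = list_of_vec a"
  define \<beta> where "\<beta> = max_entry a"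
  define N where "N = inst_size KNAPSACK (a, \<delta>)"
  \<comment> \<open>Large enough for \<open>3 * n\<close>, of size at most \<open>3 * n + 1\<close>,
    for \<open>\<beta>^2\<close> and \<open>- M\<close>, of size at most \<open>2 * max 1 N\<close>,
    and for the constants.\<close>
  define B where "B = 3 * N + 6"
  note size = kp_size_bounds[where a = a and \<delta> = \<delta>, folded N_def]
  have \<beta>: "\<beta> = fold max xs 0" unfolding \<beta>_def xs_def by (rule max_entry_eq_fold[OF inst])
  have n: "length xs = n" by (simp add: xs_def n_def)
  have "n \<le> N" using size(1) by (simp add: n_def)
  then have B1: "5 \<le> B" "int_size (int n) \<le> B" "int_size (2 * int n + 1) \<le> B" "int_size (3 * int n) \<le> B"
    "n + 1 \<le> B"
    using int_size_le_Suc_abs[of "int n"] int_size_le_Suc_abs[of "2 * int n + 1"]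
      int_size_le_Suc_abs[of "3 * int n"] by (simp_all add: B_def)
  have B2: "int_size \<delta> \<le> B" "\<forall>k\<in>set xs. int_size k \<le> B"
    using size(2,3) by (fastforce simp: B_def xs_def)+
  have "\<beta> = 0 \<or> \<beta> \<in> set xs" using fold_max_mem[of xs] by (simp add: \<beta>)
  then have "int_size \<beta> \<le> max 1 N"
  proof
    assume "\<beta> \<in> set xs"
    then show ?thesis using size(3) by (simp add: xs_def le_max_iff_disj)
  qed (simp add: int_size_def)
  then have B3: "int_size (\<beta>\<^sup>2) \<le> B" "int_size (- \<beta>\<^sup>2 - 1) \<le> B"
    using int_size_square[of \<beta>] by (auto simp: B_def)
  have M: "- (\<beta>\<^sup>2 + 1) = - \<beta>\<^sup>2 - 1" by simp
  let ?P = "registers n xs (- \<beta>\<^sup>2 - 1) \<delta> (2 * int n + 1) (3 * int n)"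
  have reads: "runs (\<lambda>s. s = \<lparr>mem = (\<lambda>_. 0), inp = int n # xs @ [\<delta>], out = []\<rparr>) input_program
      (\<lambda>s. ?P (mem s) \<and> out s = []) (60 * B * (n + 1))"
    using runs_input_program[of B xs \<delta>] B1 B2 B3 unfolding \<beta> n by blast
  have emits: "emits ?P output_program (enc_lbp (bl_lbp a \<delta> (\<beta>\<^sup>2 + 1))) (34 * (16 * B * (n + 1)\<^sup>2) + 1)"
    using emits_output_program[of B a "\<beta>\<^sup>2 + 1" \<delta>] B1 B2 B3
    unfolding M n_def[symmetric] xs_def[symmetric] by blast
  have writes: "runs (\<lambda>s. ?P (mem s) \<and> out s = []) output_program
      (\<lambda>s. out s = enc_lbp (bl_lbp a \<delta> (\<beta>\<^sup>2 + 1))) (34 * (16 * B * (n + 1)\<^sup>2) + 1)"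
    using emits[unfolded emits_def, rule_format, of "[]"] by (rule runs_weaken) simp_all
  have "B * (n + 1)\<^sup>2 \<le> B * B\<^sup>2" using B1(5) by (intro mult_le_mono power_mono) auto
  then have b3: "B * (n + 1)\<^sup>2 \<le> B ^ 3" by (simp add: power3_eq_cube power2_eq_square)
  have "B * (n + 1) \<le> B * (n + 1)\<^sup>2" by (simp add: power2_eq_square)
  then have b2: "B * (n + 1) \<le> B ^ 3" using b3 by linarith
  have b1: "1 \<le> B ^ 3" using B1(1) by simp
  \<comment> \<open>The coefficients add up to \<open>60 + 34 * 16 + 1 = 605\<close>.\<close>
  have T: "60 * B * (n + 1) + (34 * (16 * B * (n + 1)\<^sup>2) + 1) \<le> 1000 * B ^ 3"
    using b1 b2 b3 by (simp only: mult.assoc)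
  have "runs (\<lambda>s. s = \<lparr>mem = (\<lambda>_. 0), inp = int n # xs @ [\<delta>], out = []\<rparr>)
      (Seq input_program output_program)
      (\<lambda>s. out s = enc_lbp (bl_lbp a \<delta> (\<beta>\<^sup>2 + 1))) (1000 * B ^ 3)"
    using runs_Seq[OF reads writes] by (rule runs_weaken) (use T in auto)
  then show ?thesis
    unfolding enc_kp_eq n_def[symmetric] xs_def[symmetric] \<beta>_def[symmetric] N_def[symmetric]
      B_def[symmetric] by (rule runs_computes_within)
qed

lemma enc_vec_enc_rat_of_int:
  "enc_vec enc_rat (map_vec rat_of_int w) = int (dim_vec w) # entries (dim_vec w) (\<lambda>i. w $ i)"
proof -
  have "map_vec rat_of_int w = vec (dim_vec w) (\<lambda>i. rat_of_int (w $ i))"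
    by (intro eq_vecI) auto
  then show ?thesis using enc_rat_vec[of "dim_vec w" "\<lambda>i. w $ i"] by (simp add: enc_vec_def)
qed

text \<open>For an integer vector all encoded denominators are \<open>1\<close>, which is the tape
  format that \<open>copy_program\<close> expects; binary entries have constant size.\<close>

lemma computes_solution:
  assumes w: "dim_vec w = dim_vec a" "\<forall>i<dim_vec a. w $ i \<in> {0, 1}"
  shows "computes_within copy_program (enc_kp (a, \<delta>) @ enc_vec enc_rat (map_vec rat_of_int w) @ us)
    (enc_vec (\<lambda>k. [k]) w) (40 * (inst_size KNAPSACK (a, \<delta>) + 5) ^ 2)"
proof -
  define n where "n = dim_vec a"
  define N where "N = inst_size KNAPSACK (a, \<delta>)"
  define B where "B = N + 5"
  note size = kp_size_bounds[where a = a and \<delta> = \<delta>, folded N_def]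
  have "int_size k \<le> B" if "k \<in> set (list_of_vec w)" for k
  proof -
    have "k = 0 \<or> k = 1" using that w by (auto simp: list_of_vec_map)
    then show ?thesis using int_size_small[of k] by (auto simp: B_def)
  qed
  moreover have "int_size (int n) \<le> B" "int_size \<delta> \<le> B" "\<forall>k\<in>set (list_of_vec a). int_size k \<le> B"
    using size by (fastforce simp: B_def n_def)+
  moreover have "entries n (\<lambda>i. list_of_vec w ! i) = entries n (\<lambda>i. w $ i)"
    by (simp add: list_of_vec_index)
  ultimately have copy: "runs (\<lambda>s. s = \<lparr>mem = (\<lambda>_. 0),
      inp = int n # list_of_vec a @ \<delta> # int n # entries n (\<lambda>i. w $ i) @ us, out = []\<rparr>) copy_program
    (\<lambda>s. out s = int n # list_of_vec w) (40 * B * (n + 1))"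
    using runs_copy_program[of "list_of_vec w" "list_of_vec a" B \<delta> us] w(1)
    by (simp add: n_def B_def)
  have "40 * B * (n + 1) \<le> 40 * B ^ 2"
    unfolding power2_eq_square mult.assoc using size(1)
    by (intro mult_le_mono) (simp_all add: n_def B_def)
  with copy have "runs (\<lambda>s. s = \<lparr>mem = (\<lambda>_. 0),
      inp = int n # list_of_vec a @ \<delta> # int n # entries n (\<lambda>i. w $ i) @ us, out = []\<rparr>) copy_program
    (\<lambda>s. out s = int n # list_of_vec w) (40 * B ^ 2)"
    by (elim runs_weaken) simp_all
  moreover have "enc_kp (a, \<delta>) @ enc_vec enc_rat (map_vec rat_of_int w) @ us =
      int n # list_of_vec a @ \<delta> # int n # entries n (\<lambda>i. w $ i) @ us"
    "enc_vec (\<lambda>k. [k]) w = int n # list_of_vec w"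
    using w(1) by (simp_all only: enc_kp_eq enc_vec_enc_rat_of_int n_def) (simp_all add: enc_vec_def)
  ultimately show ?thesis
    unfolding N_def[symmetric] B_def[symmetric] by (simp only: runs_computes_within)
qed

text \<open>Both \<open>0\<close> and \<open>1\<close> have size at most \<open>2\<close>, so each
  pair contributes at most \<open>4\<close>.\<close>

lemma tape_size_entries:
  assumes "\<forall>i<n. f i \<in> {0, 1}"
  shows "tape_size (entries n f) \<le> 4 * n"
  using assms
proof (induction n)
  case (Suc n)
  have "int_size 0 = 1" "int_size 1 = 2"
    using int_size_le_Suc[of 1 1] by (auto simp: int_size_def bitlen_alt_def)
  then have "int_size (f n) + int_size 1 \<le> 4" using Suc.prems by auto
  moreover have "entries (Suc n) f = entries n f @ [f n, 1]" by (simp add: entries_def)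
  ultimately show ?case using Suc by (simp add: tape_size_def)
qed (simp add: entries_def tape_size_def)

lemma rvec_of_int: "rvec (map_vec rat_of_int w) = map_vec real_of_int w"
  by (intro eq_vecI) auto

lemma max_entry_less:
  "(real_of_int (max_entry a))\<^sup>2 < real_of_int ((max_entry a)\<^sup>2 + 1)"
  by simp

text \<open>Shows that the reduction is not vacuous: a knapsack optimum paired with the zero
  response is optimal. Each of the two vectors has size at most \<open>5 * N\<close>, namely
  \<open>N\<close> for its dimension and \<open>4 * N\<close> for its entries, with \<open>N\<close>
  the size of the instance.\<close>

lemma small_solution_bl_lbp:
  assumes inst: "(a, \<delta>) \<in> kp_instances" and w: "kp_optimal a \<delta> (map_vec real_of_int w)"
  defines "s \<equiv> (map_vec rat_of_int w, map_vec rat_of_int (0\<^sub>v (dim_vec a)))"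
  shows "solution BILEVEL (bl_lbp a \<delta> ((max_entry a)\<^sup>2 + 1)) s"
    "sol_size BILEVEL s \<le> 10 * inst_size KNAPSACK (a, \<delta>)"
proof -
  have "rvec (map_vec rat_of_int (0\<^sub>v (dim_vec a))) = 0\<^sub>v (dim_vec a)"
    by (intro eq_vecI) auto
  then show "solution BILEVEL (bl_lbp a \<delta> ((max_entry a)\<^sup>2 + 1)) s"
    using kp_optimal_bl_optimal[OF inst max_entry_less w]
    by (simp only: s_def BILEVEL_def problem.simps prod.case lbp_optimal_bl_lbp rvec_of_int)
  define n where "n = dim_vec a"
  have bin: "binary_vec n (map_vec real_of_int w)"
    using w by (simp add: kp_optimal_def is_arg_max_def kp_feasible_def n_def)
  then have d: "dim_vec w = n" and w01: "\<forall>i<n. w $ i \<in> {0, 1}"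
    by (auto simp: binary_vec_def)
  have "enc_sol BILEVEL s = int n # entries n (\<lambda>i. w $ i) @ int n # entries n (\<lambda>i. 0\<^sub>v n $ i)"
    unfolding s_def BILEVEL_def problem.simps prod.case enc_vec_enc_rat_of_int
    by (simp add: d n_def)
  then have "sol_size BILEVEL s =
      int_size (int n) + tape_size (entries n (\<lambda>i. w $ i)) +
      (int_size (int n) + tape_size (entries n (\<lambda>i. 0\<^sub>v n $ i)))"
    by (simp add: sol_size_def tape_size_def)
  also have "\<dots> \<le> int_size (int n) + 4 * n + (int_size (int n) + 4 * n)"
    by (intro add_mono tape_size_entries) (use w01 in auto)
  also have "\<dots> \<le> 10 * inst_size KNAPSACK (a, \<delta>)"
    using kp_size_bounds(1,4)[of a \<delta>] by (simp add: n_def)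
  finally show "sol_size BILEVEL s \<le> 10 * inst_size KNAPSACK (a, \<delta>)" .
qed

text \<open>A rational optimum has binary \<open>x\<close>, so taking floors loses nothing and
  yields the integer vector that KNAPSACK asks for.\<close>

lemma solution_from_bl_lbp:
  assumes inst: "(a, \<delta>) \<in> kp_instances"
    and s: "solution BILEVEL (bl_lbp a \<delta> ((max_entry a)\<^sup>2 + 1)) (x, y)"
  shows "\<exists>w. kp_optimal a \<delta> (map_vec real_of_int w) \<and> map_vec rat_of_int w = x \<and>
    dim_vec w = dim_vec a \<and> (\<forall>i<dim_vec a. w $ i \<in> {0, 1})"
proof -
  have "bl_optimal a \<delta> (real_of_int ((max_entry a)\<^sup>2 + 1)) (rvec x, rvec y)"
    using s by (simp only: BILEVEL_def problem.simps prod.case lbp_optimal_bl_lbp)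
  then have opt: "kp_optimal a \<delta> (rvec x)"
    using bl_optimal_integer[OF inst max_entry_less] by blast
  then have "binary_vec (dim_vec a) (rvec x)"
    by (simp add: kp_optimal_def is_arg_max_def kp_feasible_def)
  then have d: "dim_vec x = dim_vec a" and x: "x $ i = 0 \<or> x $ i = 1" if "i < dim_vec a" for i
    using that by (auto simp: binary_vec_def)
  \<comment> \<open>The equation obtained just before depends on an index
    \<open>i < dim_vec a\<close>; this one is unconditional.\<close>
  have d: "dim_vec x = dim_vec a"
    using \<open>binary_vec (dim_vec a) (rvec x)\<close> by (simp add: binary_vec_def)
  define w where "w = map_vec floor x"
  have wx: "map_vec rat_of_int w = x"
    by (intro eq_vecI) (use x d in \<open>fastforce simp: w_def\<close>)+
  have "map_vec real_of_int w = rvec x" unfolding wx[symmetric] rvec_of_int ..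
  moreover have "\<forall>i<dim_vec a. w $ i \<in> {0, 1}"
    using x d by (fastforce simp: w_def)
  moreover have "dim_vec w = dim_vec a" using d by (simp add: w_def)
  ultimately show ?thesis using opt wx by (intro exI[of _ w]) simp
qed

lemma poly_time_reduction_bl_lbp:
  "poly_time_reduction KNAPSACK BILEVEL (\<lambda>(a, \<delta>). bl_lbp a \<delta> ((max_entry a)\<^sup>2 + 1))"
  unfolding poly_time_reduction_def
proof (intro conjI)
  let ?f = "\<lambda>(a, \<delta>). bl_lbp a \<delta> ((max_entry a)\<^sup>2 + 1)"
  have KP: "instances KNAPSACK = kp_instances" "enc_inst KNAPSACK = enc_kp"
    "solution KNAPSACK (a, \<delta>) w = kp_optimal a \<delta> (map_vec real_of_int w)"
    "enc_sol KNAPSACK = enc_vec (\<lambda>k. [k])" for a \<delta> w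
    by (simp_all add: KNAPSACK_def)
  have BL: "instances BILEVEL = lbp_instances" "enc_inst BILEVEL = enc_lbp"
    "enc_sol BILEVEL (x, y) = enc_vec enc_rat x @ enc_vec enc_rat y" for x y
    by (simp_all add: BILEVEL_def)
  show "?f ` instances KNAPSACK \<subseteq> instances BILEVEL"
    using bl_lbp_in_instances by (auto simp: BL)
  show "\<exists>c (p :: nat poly). \<forall>J\<in>instances KNAPSACK.
      computes_within c (enc_inst KNAPSACK J) (enc_inst BILEVEL (?f J)) (poly p (inst_size KNAPSACK J))"
  proof (intro exI ballI)
    fix J assume "J \<in> instances KNAPSACK"
    then show "computes_within (Seq input_program output_program) (enc_inst KNAPSACK J)
        (enc_inst BILEVEL (?f J)) (poly ([:1000:] * [:6, 3:] ^ 3) (inst_size KNAPSACK J))"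
      using computes_bl_lbp by (cases J) (auto simp: KP BL poly_power algebra_simps)
  qed
  show "\<exists>q :: nat poly. \<forall>J\<in>instances KNAPSACK. (\<exists>w. solution KNAPSACK J w) \<longrightarrow>
      (\<exists>s. solution BILEVEL (?f J) s \<and> sol_size BILEVEL s \<le> poly q (inst_size KNAPSACK J))"
  proof (intro exI[of _ "[:0, 10:]"] ballI impI)
    fix J assume J: "J \<in> instances KNAPSACK" "\<exists>w. solution KNAPSACK J w"
    obtain a \<delta> where "J = (a, \<delta>)" by (cases J)
    with J small_solution_bl_lbp show "\<exists>s. solution BILEVEL (?f J) s \<and>
        sol_size BILEVEL s \<le> poly [:0, 10:] (inst_size KNAPSACK J)"
      by (fastforce simp: KP mult.commute)
  qed
  show "\<exists>c. \<forall>q :: nat poly. \<exists>p :: nat poly. \<forall>J\<in>instances KNAPSACK. \<forall>s.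
      solution BILEVEL (?f J) s \<and> sol_size BILEVEL s \<le> poly q (inst_size KNAPSACK J) \<longrightarrow>
      (\<exists>w. solution KNAPSACK J w \<and> computes_within c (enc_inst KNAPSACK J @ enc_sol BILEVEL s)
         (enc_sol KNAPSACK w) (poly p (inst_size KNAPSACK J)))"
  \<comment> \<open>One polynomial serves every \<open>q\<close>: the optimal \<open>x\<close> is
    binary, so copying it takes time bounded in terms of \<open>J\<close> alone, and the encoding of
    \<open>y\<close> is left on the tape.\<close>
  proof (rule exI, rule allI, rule exI, intro ballI allI impI)
    fix q :: "nat poly" and J s
    assume J: "J \<in> instances KNAPSACK"
      and s: "solution BILEVEL (?f J) s \<and> sol_size BILEVEL s \<le> poly q (inst_size KNAPSACK J)"
    obtain a \<delta> where a: "J = (a, \<delta>)" by (cases J)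
    obtain x y where xy: "s = (x, y)" by (cases s)
    have inst: "(a, \<delta>) \<in> kp_instances" using J by (simp add: KP a)
    have "solution BILEVEL (bl_lbp a \<delta> ((max_entry a)\<^sup>2 + 1)) (x, y)"
      using s by (simp add: a xy)
    from solution_from_bl_lbp[OF inst this] obtain w where w:
      "kp_optimal a \<delta> (map_vec real_of_int w)" "map_vec rat_of_int w = x"
      "dim_vec w = dim_vec a" "\<forall>i<dim_vec a. w $ i \<in> {0, 1}" by blast
    have "poly ([:40:] * [:5, 1:] ^ 2) N = 40 * (N + 5) ^ 2" for N :: nat
      by (simp add: poly_power add.commute)
    with computes_solution[OF w(3,4), of \<delta> "enc_vec enc_rat y"] w(1,2)
    show "\<exists>w. solution KNAPSACK J w \<and> computes_within copy_program (enc_inst KNAPSACK J @ enc_sol BILEVEL s)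
         (enc_sol KNAPSACK w) (poly ([:40:] * [:5, 1:] ^ 2) (inst_size KNAPSACK J))"
      unfolding a xy KP BL by (intro exI[of _ w]) (simp only: simp_thms)
  qed
qed

theorem theorem3p3p4:
  shows "(\<forall>a \<delta> (M :: real). (a, \<delta>) \<in> kp_instances \<and> M > (real_of_int (max_entry a))\<^sup>2 \<longrightarrow>
           (\<forall>x y. bl_feasible a \<delta> (x, y) \<and> \<not> integer_vec x \<longrightarrow>
              (\<exists>z. binary_vec (dim_vec a) z \<and> bl_feasible a \<delta> (z, 0\<^sub>v (dim_vec a)) \<and>
                   weight a x - M * (\<Sum>i<dim_vec a. y $ i) < weight a z)) \<and>
           (\<forall>x y. bl_optimal a \<delta> M (x, y) \<longrightarrow>
              integer_vec x \<and> integer_vec y \<and> kp_optimal a \<delta> x)) \<and>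
         poly_time_reduction KNAPSACK BILEVEL
           (\<lambda>(a, \<delta>). bl_lbp a \<delta> ((max_entry a)\<^sup>2 + 1))"
proof (intro conjI allI impI)
  fix a \<delta> x y and M :: real
  assume inst: "(a, \<delta>) \<in> kp_instances \<and> M > (real_of_int (max_entry a))\<^sup>2"
  show "\<exists>z. binary_vec (dim_vec a) z \<and> bl_feasible a \<delta> (z, 0\<^sub>v (dim_vec a)) \<and>
      weight a x - M * (\<Sum>i<dim_vec a. y $ i) < weight a z"
    if "bl_feasible a \<delta> (x, y) \<and> \<not> integer_vec x"
  proof -
    from fractional_dominated[of a \<delta> M x y] inst that
    obtain z where "kp_feasible a \<delta> z" "bl_objective a M (x, y) < weight a z" by blast
    moreover from this have "binary_vec (dim_vec a) z" by (simp add: kp_feasible_def)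
    ultimately show ?thesis by (auto simp: kp_feasible_iff_bl_feasible bl_objective_def)
  qed
  \<comment> \<open>Integrality of \<open>y\<close> holds because an integer \<open>x\<close> makes
    it the zero vector.\<close>
  show "integer_vec x" "integer_vec y" "kp_optimal a \<delta> x" if "bl_optimal a \<delta> M (x, y)"
    using bl_optimal_integer[of a \<delta> M x y] inst that by (auto simp: integer_vec_def)
qed (rule poly_time_reduction_bl_lbp)

end
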